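(* Let $(X,d,\mu,\mathcal{E},\mathcal{F})$ be an Ahlfors $d_H$-regular strongly local regular symmetric Dirichlet space that satisfies sub-Gaussian heat kernel estimates with walk dimension $d_W$ and the weak Bakry–Émery condition $BE(\kappa)$ with $0<\kappa\le\frac{d_W}2$. For $p\ge1$ let $\alpha_p^*(X)=\inf\{\alpha>0:\mathbf{B}^{p,\alpha}(X)\text{ is trivial}\}$. Then: (i) for $1\le p\le2$, \[ \frac12\le\alpha_p^*(X)\le\left(1-\frac2p\right)\frac{\kappa}{d_W}+\frac1p; \] (ii) for $p\ge2$, \[ \left(1-\frac2p\right)\frac{\kappa}{d_W}+\frac1p\le\alpha_p^*(X)\le\frac12 . \]
   Context: $(X,d,\mu)$ is a metric measure space whose balls $B(x,r)=\{y:d(x,y)<r\}$ have compact closure; $\mathcal{E}$ is a strongly local regular symmetric Dirichlet form on $L^2(X,\mu)$ with domain $\mathcal{F}$ and conservative semigroup $P_t$ ($P_t1=1$), extended to all $L^p(X,\mu)$. Ahlfors $d_H$-regular: there are $c_1,c_2,d_H\in(0,\infty)$ with $c_1r^{d_H}\le\mu(B(x,r))\le c_2r^{d_H}$ for all $x\in X$, $r\in(0,\infty)$. Sub-Gaussian heat kernel estimates: $P_t$ has a measurable heat kernel $p_t(x,y)$ and for some $c_3,c_4,c_5,c_6\in(0,\infty)$, $d_W\in[2,\infty)$, \[ c_5t^{-d_H/d_W}\exp\left(-c_6\left(\tfrac{d(x,y)^{d_W}}t\right)^{\frac1{d_W-1}}\right)\le p_t(x,y)\le c_3t^{-d_H/d_W}\exp\left(-c_4\left(\tfrac{d(x,y)^{d_W}}t\right)^{\frac1{d_W-1}}\right)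 \] for $\mu\times\mu$-a.e. $(x,y)$ and each $t\in(0,\infty)$. $BE(\kappa)$: there is $C>0$ such that for all $t>0$, $g\in L^\infty(X,\mu)$, $x,y\in X$, \[ |P_tg(x)-P_tg(y)|\le C\,\frac{d(x,y)^\kappa}{t^{\kappa/d_W}}\,\|g\|_{L^\infty(X,\mu)}. \] For $p\ge1$, $\alpha\ge0$: $\|f\|_{p,\alpha}=\sup_{t>0}t^{-\alpha}\left(\int_X\int_X|f(x)-f(y)|^pp_t(x,y)\,d\mu(x)\,d\mu(y)\right)^{1/p}$, and $\mathbf{B}^{p,\alpha}(X)=\{f\in L^p(X,\mu):\|f\|_{p,\alpha}<\infty\}$. $\mathbf{B}^{p,\alpha}(X)$ is trivial if each of its elements is ($\mu$-a.e.) constant. *)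

theory Defs
  imports "HOL-Analysis.Analysis" "HOL-Probability.Essential_Supremum"
begin

text \<open>
  The space \<open>X\<close> is the whole type \<open>'a\<close>. Elements of Lebesgue spaces are represented by
  functions; identities between them are stated almost everywhere.
\<close>

definition metric_measure_space :: "'a::metric_space measure \<Rightarrow> bool" where
  "metric_measure_space M \<longleftrightarrow>
     sets M = sets borel \<and> (\<forall>(x::'a) r. compact (closure (ball x r)))"

definition ahlfors_regular :: "'a::metric_space measure \<Rightarrow> real \<Rightarrow> bool" where
  "ahlfors_regular M dH \<longleftrightarrow> dH > 0 \<and>
     (\<exists>c1>0. \<exists>c2>0. \<forall>x. \<forall>r>0.
        ennreal (c1 * r powr dH) \<le> emeasure M (ball x r) \<and>
        emeasure M (ball x r) \<le> ennreal (c2 * r powr dH))"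


subsection \<open>Lebesgue spaces\<close>

definition Lp :: "'a measure \<Rightarrow> real \<Rightarrow> ('a \<Rightarrow> real) set" where
  "Lp M p = {f \<in> borel_measurable M. integrable M (\<lambda>x. \<bar>f x\<bar> powr p)}"

definition Lp_norm :: "'a measure \<Rightarrow> real \<Rightarrow> ('a \<Rightarrow> real) \<Rightarrow> real" where
  "Lp_norm M p f = (\<integral>x. \<bar>f x\<bar> powr p \<partial>M) powr (1 / p)"

definition Linf :: "'a measure \<Rightarrow> ('a \<Rightarrow> real) set" where
  "Linf M = {f \<in> borel_measurable M. esssup M (\<lambda>x. ennreal \<bar>f x\<bar>) < \<infinity>}"

definition Linf_norm :: "'a measure \<Rightarrow> ('a \<Rightarrow> real) \<Rightarrow> real" where
  "Linf_norm M f = enn2real (esssup M (\<lambda>x. ennreal \<bar>f x\<bar>))"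

definition L2_inner :: "'a measure \<Rightarrow> ('a \<Rightarrow> real) \<Rightarrow> ('a \<Rightarrow> real) \<Rightarrow> real" where
  "L2_inner M f g = (\<integral>x. f x * g x \<partial>M)"


subsection \<open>Symmetric Dirichlet forms\<close>

definition form_norm ::
  "'a measure \<Rightarrow> (('a \<Rightarrow> real) \<Rightarrow> ('a \<Rightarrow> real) \<Rightarrow> real) \<Rightarrow> ('a \<Rightarrow> real) \<Rightarrow> real" where
  "form_norm M \<E> f = sqrt (\<E> f f + L2_inner M f f)"

definition symmetric_form ::
  "'a measure \<Rightarrow> (('a \<Rightarrow> real) \<Rightarrow> ('a \<Rightarrow> real) \<Rightarrow> real) \<Rightarrow> ('a \<Rightarrow> real) set \<Rightarrow> bool" where
  "symmetric_form M \<E> \<F> \<longleftrightarrow>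
     \<F> \<subseteq> Lp M 2 \<and>
     (\<lambda>x. 0) \<in> \<F> \<and>
     (\<forall>f\<in>\<F>. \<forall>g\<in>\<F>. \<forall>a b. (\<lambda>x. a * f x + b * g x) \<in> \<F>) \<and>
     (\<forall>f\<in>Lp M 2. \<forall>e>0. \<exists>g\<in>\<F>. Lp_norm M 2 (\<lambda>x. f x - g x) < e) \<and>
     \<comment> \<open>compatibility with equality almost everywhere\<close>
     (\<forall>f\<in>\<F>. \<forall>g\<in>borel_measurable M. (AE x in M. f x = g x) \<longrightarrow>
        g \<in> \<F> \<and> (\<forall>h\<in>\<F>. \<E> f h = \<E> g h)) \<and>
     (\<forall>f\<in>\<F>. \<forall>g\<in>\<F>. \<forall>h\<in>\<F>. \<forall>a b.
        \<E> (\<lambda>x. a * f x + b * g x) h = a * \<E> f h + b * \<E> g h) \<and>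
     (\<forall>f\<in>\<F>. \<forall>g\<in>\<F>. \<E> f g = \<E> g f) \<and>
     (\<forall>f\<in>\<F>. \<E> f f \<ge> 0)"

definition closed_form ::
  "'a measure \<Rightarrow> (('a \<Rightarrow> real) \<Rightarrow> ('a \<Rightarrow> real) \<Rightarrow> real) \<Rightarrow> ('a \<Rightarrow> real) set \<Rightarrow> bool" where
  "closed_form M \<E> \<F> \<longleftrightarrow>
     (\<forall>u :: nat \<Rightarrow> 'a \<Rightarrow> real.
        (\<forall>n. u n \<in> \<F>) \<and>
        (\<forall>e>0. \<exists>N. \<forall>m\<ge>N. \<forall>n\<ge>N. form_norm M \<E> (\<lambda>x. u m x - u n x) < e) \<longrightarrow>
        (\<exists>f\<in>\<F>. (\<lambda>n. form_norm M \<E> (\<lambda>x. u n x - f x)) \<longlonglongrightarrow> 0))"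

definition markovian_form ::
  "(('a \<Rightarrow> real) \<Rightarrow> ('a \<Rightarrow> real) \<Rightarrow> real) \<Rightarrow> ('a \<Rightarrow> real) set \<Rightarrow> bool" where
  "markovian_form \<E> \<F> \<longleftrightarrow>
     (\<forall>f\<in>\<F>. (\<lambda>x. min (max (f x) 0) 1) \<in> \<F> \<and>
        \<E> (\<lambda>x. min (max (f x) 0) 1) (\<lambda>x. min (max (f x) 0) 1) \<le> \<E> f f)"

definition dirichlet_form ::
  "'a measure \<Rightarrow> (('a \<Rightarrow> real) \<Rightarrow> ('a \<Rightarrow> real) \<Rightarrow> real) \<Rightarrow> ('a \<Rightarrow> real) set \<Rightarrow> bool" where
  "dirichlet_form M \<E> \<F> \<longleftrightarrow>
     symmetric_form M \<E> \<F> \<and> closed_form M \<E> \<F> \<and> markovian_form \<E> \<F>"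

definition Cc :: "('a::topological_space \<Rightarrow> real) set" where
  "Cc = {f. continuous_on UNIV f \<and> compact (closure {x. f x \<noteq> 0})}"

definition regular_form ::
  "'a::metric_space measure \<Rightarrow> (('a \<Rightarrow> real) \<Rightarrow> ('a \<Rightarrow> real) \<Rightarrow> real) \<Rightarrow> ('a \<Rightarrow> real) set \<Rightarrow> bool" where
  "regular_form M \<E> \<F> \<longleftrightarrow>
     (\<forall>f\<in>\<F>. \<forall>e>0. \<exists>g\<in>\<F> \<inter> Cc. form_norm M \<E> (\<lambda>x. f x - g x) < e) \<and>
     (\<forall>f\<in>Cc. \<forall>e>0. \<exists>g\<in>\<F> \<inter> Cc. \<forall>x. \<bar>f x - g x\<bar> < e)"

text \<open>The support of the (signed) measure with density \<open>f\<close>; unlike the closure of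
  \<open>{x. f x \<noteq> 0}\<close> it depends only on the class of \<open>f\<close>.\<close>

definition ess_support :: "'a::topological_space measure \<Rightarrow> ('a \<Rightarrow> real) \<Rightarrow> 'a set" where
  "ess_support M f = {x. \<forall>U. open U \<and> x \<in> U \<longrightarrow> \<not> (AE y in M. y \<in> U \<longrightarrow> f y = 0)}"

definition strongly_local_form ::
  "'a::metric_space measure \<Rightarrow> (('a \<Rightarrow> real) \<Rightarrow> ('a \<Rightarrow> real) \<Rightarrow> real) \<Rightarrow> ('a \<Rightarrow> real) set \<Rightarrow> bool" where
  "strongly_local_form M \<E> \<F> \<longleftrightarrow>
     (\<forall>f\<in>\<F>. \<forall>g\<in>\<F>.
        compact (ess_support M f) \<and> compact (ess_support M g) \<and>
        (\<exists>U c. open U \<and> ess_support M f \<subseteq> U \<and> (AE x in M. x \<in> U \<longrightarrow> g x = c)) \<longrightarrow>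
        \<E> f g = 0)"


subsection \<open>The heat semigroup\<close>

definition Lp_contraction :: "'a measure \<Rightarrow> real \<Rightarrow> (('a \<Rightarrow> real) \<Rightarrow> 'a \<Rightarrow> real) \<Rightarrow> bool" where
  "Lp_contraction M p T \<longleftrightarrow>
     (\<forall>f\<in>Lp M p. T f \<in> Lp M p \<and> Lp_norm M p (T f) \<le> Lp_norm M p f) \<and>
     (\<forall>f\<in>Lp M p. \<forall>g\<in>Lp M p. \<forall>a b.
        AE x in M. T (\<lambda>y. a * f y + b * g y) x = a * T f x + b * T g x)"

definition L2_semigroup :: "'a measure \<Rightarrow> (real \<Rightarrow> ('a \<Rightarrow> real) \<Rightarrow> 'a \<Rightarrow> real) \<Rightarrow> bool" where
  "L2_semigroup M P \<longleftrightarrow>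
     (\<forall>t>0. Lp_contraction M 2 (P t)) \<and>
     (\<forall>t>0. \<forall>f\<in>Lp M 2. \<forall>g\<in>Lp M 2. L2_inner M (P t f) g = L2_inner M f (P t g)) \<and>
     (\<forall>s>0. \<forall>t>0. \<forall>f\<in>Lp M 2. AE x in M. P (s + t) f x = P s (P t f) x) \<and>
     (\<forall>f\<in>Lp M 2. ((\<lambda>t. Lp_norm M 2 (\<lambda>x. P t f x - f x)) \<longlongrightarrow> 0) (at_right 0))"

text \<open>The semigroup belongs to the form if its infinitesimal generator \<open>L\<close> is the operator with
  \<open>\<E>(f, g) = - \<langle>L f, g\<rangle>\<close> for all \<open>g \<in> \<F>\<close>. Both operators are given by their graphs, with
  \<open>h\<close> in the role of \<open>L f\<close>.\<close>

definition semigroup_generator ::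
  "'a measure \<Rightarrow> (real \<Rightarrow> ('a \<Rightarrow> real) \<Rightarrow> 'a \<Rightarrow> real) \<Rightarrow> ('a \<Rightarrow> real) \<Rightarrow> ('a \<Rightarrow> real) \<Rightarrow> bool" where
  "semigroup_generator M P f h \<longleftrightarrow> f \<in> Lp M 2 \<and> h \<in> Lp M 2 \<and>
     ((\<lambda>t. Lp_norm M 2 (\<lambda>x. (P t f x - f x) / t - h x)) \<longlongrightarrow> 0) (at_right 0)"

definition form_generator ::
  "'a measure \<Rightarrow> (('a \<Rightarrow> real) \<Rightarrow> ('a \<Rightarrow> real) \<Rightarrow> real) \<Rightarrow> ('a \<Rightarrow> real) set \<Rightarrow>
     ('a \<Rightarrow> real) \<Rightarrow> ('a \<Rightarrow> real) \<Rightarrow> bool" where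
  "form_generator M \<E> \<F> f h \<longleftrightarrow> f \<in> \<F> \<and> h \<in> Lp M 2 \<and>
     (\<forall>g\<in>\<F>. \<E> f g = - L2_inner M h g)"

text \<open>The extension to \<open>L\<^sup>q\<close> for finite \<open>q\<close> is determined by linearity and contractivity, since
  \<open>L\<^sup>2 \<inter> L\<^sup>q\<close> is dense; the one to \<open>L\<^sup>\<infinity>\<close> is the dual of the one to \<open>L\<^sup>1\<close>.\<close>

definition extends_to_Lp :: "'a measure \<Rightarrow> (real \<Rightarrow> ('a \<Rightarrow> real) \<Rightarrow> 'a \<Rightarrow> real) \<Rightarrow> bool" where
  "extends_to_Lp M P \<longleftrightarrow>
     (\<forall>t>0. \<forall>q\<ge>1. Lp_contraction M q (P t)) \<and>
     (\<forall>t>0. \<forall>g\<in>Linf M. P t g \<in> Linf M \<and>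
        (\<forall>f\<in>Lp M 1. (\<integral>x. f x * P t g x \<partial>M) = (\<integral>x. P t f x * g x \<partial>M)))"

definition heat_semigroup ::
  "'a measure \<Rightarrow> (('a \<Rightarrow> real) \<Rightarrow> ('a \<Rightarrow> real) \<Rightarrow> real) \<Rightarrow> ('a \<Rightarrow> real) set \<Rightarrow>
     (real \<Rightarrow> ('a \<Rightarrow> real) \<Rightarrow> 'a \<Rightarrow> real) \<Rightarrow> bool" where
  "heat_semigroup M \<E> \<F> P \<longleftrightarrow>
     L2_semigroup M P \<and>
     (\<forall>f h. semigroup_generator M P f h \<longleftrightarrow> form_generator M \<E> \<F> f h) \<and>
     extends_to_Lp M P"

definition conservative :: "'a measure \<Rightarrow> (real \<Rightarrow> ('a \<Rightarrow> real) \<Rightarrow> 'a \<Rightarrow> real) \<Rightarrow> bool" where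
  "conservative M P \<longleftrightarrow> (\<forall>t>0. AE x in M. P t (\<lambda>_. 1) x = 1)"

definition heat_kernel ::
  "'a measure \<Rightarrow> (real \<Rightarrow> ('a \<Rightarrow> real) \<Rightarrow> 'a \<Rightarrow> real) \<Rightarrow> (real \<Rightarrow> 'a \<Rightarrow> 'a \<Rightarrow> real) \<Rightarrow> bool" where
  "heat_kernel M P k \<longleftrightarrow>
     (\<forall>t>0. (\<lambda>(x, y). k t x y) \<in> borel_measurable (M \<Otimes>\<^sub>M M) \<and>
        (\<forall>f\<in>Lp M 2. AE x in M. integrable M (\<lambda>y. k t x y * f y) \<and>
           P t f x = (\<integral>y. k t x y * f y \<partial>M)))"

definition sub_gaussian_estimates ::
  "'a::metric_space measure \<Rightarrow> (real \<Rightarrow> 'a \<Rightarrow> 'a \<Rightarrow> real) \<Rightarrow> real \<Rightarrow> real \<Rightarrow> bool" where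
  "sub_gaussian_estimates M k dH dW \<longleftrightarrow> dW \<ge> 2 \<and>
     (\<exists>c3>0. \<exists>c4>0. \<exists>c5>0. \<exists>c6>0. \<forall>t>0. AE (x, y) in M \<Otimes>\<^sub>M M.
        c5 * t powr (- dH / dW) * exp (- c6 * (dist x y powr dW / t) powr (1 / (dW - 1)))
          \<le> k t x y \<and>
        k t x y
          \<le> c3 * t powr (- dH / dW) * exp (- c4 * (dist x y powr dW / t) powr (1 / (dW - 1))))"

text \<open>As \<open>P t g\<close> is only determined up to null sets, the pointwise estimate is required of some
  representative \<open>h\<close> (which is then its unique continuous representative).\<close>

definition weak_bakry_emery ::
  "'a::metric_space measure \<Rightarrow> (real \<Rightarrow> ('a \<Rightarrow> real) \<Rightarrow> 'a \<Rightarrow> real) \<Rightarrow> real \<Rightarrow> real \<Rightarrow> bool" where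
  "weak_bakry_emery M P dW \<kappa> \<longleftrightarrow>
     (\<exists>C>0. \<forall>t>0. \<forall>g\<in>Linf M. \<exists>h. (AE x in M. P t g x = h x) \<and>
        (\<forall>x y. \<bar>h x - h y\<bar> \<le> C * (dist x y powr \<kappa> / t powr (\<kappa> / dW)) * Linf_norm M g))"


subsection \<open>Heat semigroup based Besov classes\<close>

definition ennreal_powr :: "ennreal \<Rightarrow> real \<Rightarrow> ennreal" where
  "ennreal_powr a s = (if a = \<infinity> then \<infinity> else ennreal (enn2real a powr s))"

definition besov_seminorm ::
  "'a measure \<Rightarrow> (real \<Rightarrow> 'a \<Rightarrow> 'a \<Rightarrow> real) \<Rightarrow> real \<Rightarrow> real \<Rightarrow> ('a \<Rightarrow> real) \<Rightarrow> ennreal" where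
  "besov_seminorm M k p \<alpha> f =
     (SUP t\<in>{0<..}. ennreal (t powr (- \<alpha>)) *
        ennreal_powr (\<integral>\<^sup>+ y. \<integral>\<^sup>+ x. ennreal (\<bar>f x - f y\<bar> powr p * k t x y) \<partial>M \<partial>M) (1 / p))"

definition besov_space ::
  "'a measure \<Rightarrow> (real \<Rightarrow> 'a \<Rightarrow> 'a \<Rightarrow> real) \<Rightarrow> real \<Rightarrow> real \<Rightarrow> ('a \<Rightarrow> real) set" where
  "besov_space M k p \<alpha> = {f \<in> Lp M p. besov_seminorm M k p \<alpha> f < \<infinity>}"

definition besov_trivial ::
  "'a measure \<Rightarrow> (real \<Rightarrow> 'a \<Rightarrow> 'a \<Rightarrow> real) \<Rightarrow> real \<Rightarrow> real \<Rightarrow> bool" where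
  "besov_trivial M k p \<alpha> \<longleftrightarrow> (\<forall>f\<in>besov_space M k p \<alpha>. \<exists>c. AE x in M. f x = c)"

text \<open>Extended real valued, so that the infimum of the empty set is \<open>\<infinity>\<close>.\<close>

definition critical_exponent ::
  "'a measure \<Rightarrow> (real \<Rightarrow> 'a \<Rightarrow> 'a \<Rightarrow> real) \<Rightarrow> real \<Rightarrow> ereal" where
  "critical_exponent M k p = (INF \<alpha>\<in>{\<alpha>. \<alpha> > 0 \<and> besov_trivial M k p \<alpha>}. ereal \<alpha>)"

end

theory Submission
  imports Defs
begin

text \<open>
  Write \<open>E\<^sub>p\<^sub>,\<^sub>t(f)\<close> for the double integral of \<open>|f(x) - f(y)|\<^sup>p\<close> against the heat kernel at time \<open>t\<close>,
  a measure on pairs whose marginals are \<open>\<mu>\<close>. By the semigroup law \<open>\<phi>(r) = \<langle>P\<^sub>r g, g\<rangle>\<close> is bounded and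
  convex along arithmetic progressions, so \<open>E\<^sub>2\<^sub>,\<^sub>t(P\<^sub>s g) = 2(\<phi>(2s) - \<phi>(2s + t))\<close> is of order \<open>t / s\<close>. For
  \<open>q \<ge> 2\<close> the weak Bakry-Emery condition and the kernel comparison
  \<open>d(x,y)\<^sup>\<beta> p\<^sub>t(x,y) \<le> C t\<^bsup>\<beta>/d\<^sub>W\<^esup> p\<^bsub>ct\<^esub>(x,y)\<close> improve this to
  \<open>E\<^sub>q\<^sub>,\<^sub>t(P\<^sub>s g) \<le> C t\<^bsup>1 + \<kappa>(q - 2)/d\<^sub>W\<^esup>\<close>, which is the lower bound in (ii). Truncating \<open>P\<^sub>1 g\<close> to a
  function supported on a set of finite measure, where \<open>L\<^sup>2\<close> controls \<open>L\<^sup>p\<close>, gives the lower bound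
  in (i). For the upper bounds, a Besov function may likewise be truncated to a bounded \<open>g\<close> with support of
  finite measure; then \<open>2|\<phi>(r) - \<phi>(r + t)|\<close> is the modulus of the pairing of the differences of \<open>g\<close> and of
  \<open>P\<^sub>r g\<close>, which by Young's inequality is \<open>O(t\<^sup>e)\<close> with \<open>e > 1\<close>. So \<open>\<phi>\<close> is constant, hence zero
  by heat kernel decay, and \<open>2\<parallel>g\<parallel>\<^sup>2 = E\<^sub>2\<^sub>,\<^sub>t(g)\<close> tends to \<open>0\<close> with \<open>t\<close>.
\<close>

text \<open>A cutoff that does not increase differences and vanishes up to level \<epsilon>. For
  \<epsilon> > 0 it turns a function of an L^p class into one with values in [0, 1] and support of
  finite measure.\<close>

definition clip :: "real \<Rightarrow> real \<Rightarrow> real" where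
  "clip \<epsilon> r = min 1 (max 0 (r - \<epsilon>))"

section \<open>Lebesgue spaces and inequalities on the real line\<close>

lemma Lp_iff: "f \<in> Lp M p \<longleftrightarrow> f \<in> borel_measurable M \<and> integrable M (\<lambda>x. \<bar>f x\<bar> powr p)"
  by (simp add: Lp_def)

lemma Lp_measurable: "f \<in> Lp M p \<Longrightarrow> f \<in> borel_measurable M"
  by (simp add: Lp_def)

lemma Lp_2_iff: "f \<in> Lp M 2 \<longleftrightarrow> f \<in> borel_measurable M \<and> integrable M (\<lambda>x. (f x)\<^sup>2)"
  by (simp add: Lp_def)

lemma Lp_1_iff: "f \<in> Lp M 1 \<longleftrightarrow> integrable M f"
  by (auto simp: Lp_def powr_one' integrable_abs_iff)

lemma Lp_indicator:
  assumes "A \<in> sets M" "emeasure M A < \<infinity>" "p > 0"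
  shows "indicator A \<in> Lp M p"
proof -
  have "(\<lambda>x. \<bar>indicator A x :: real\<bar> powr p) = indicator A"
    by (auto simp: indicator_def fun_eq_iff)
  then show ?thesis
    using assms by (auto simp: Lp_def integrable_indicator_iff)
qed

lemma L2_integrable_mult:
  fixes f g :: "'a \<Rightarrow> real"
  assumes "f \<in> Lp M 2" "g \<in> Lp M 2"
  shows "integrable M (\<lambda>x. f x * g x)"
proof (rule Bochner_Integration.integrable_bound)
  show "integrable M (\<lambda>x. (f x)\<^sup>2 + (g x)\<^sup>2)"
    using assms by (auto simp: Lp_2_iff)
  show "(\<lambda>x. f x * g x) \<in> borel_measurable M"
    using assms by (auto simp: Lp_2_iff)
  have "\<bar>a * b\<bar> \<le> a\<^sup>2 + b\<^sup>2" for a b :: real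
    using sum_squares_bound[of "\<bar>a\<bar>" "\<bar>b\<bar>"] abs_ge_zero[of "a * b"] abs_mult[of a b]
      power2_abs[of a] power2_abs[of b] by linarith
  then show "AE x in M. norm (f x * g x) \<le> norm ((f x)\<^sup>2 + (g x)\<^sup>2)"
    by (auto simp: abs_mult)
qed

text \<open>Convexity makes successive decrements over steps of length \<open>t\<close> decrease.
  The one starting at \<open>2 * s\<close> is therefore at most the average of the \<open>n\<close>
  decrements before it, which together amount to at most \<open>K\<close>. For \<open>t > s\<close>
  the trivial bound \<open>K\<close> is enough.\<close>

lemma convex_decrement_bound:
  fixes \<phi> :: "real \<Rightarrow> real"
  assumes convex: "\<And>r t. r > 0 \<Longrightarrow> t > 0 \<Longrightarrow> 2 * \<phi> (r + t) \<le> \<phi> r + \<phi> (r + 2 * t)"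
    and nonneg: "\<And>r. r > 0 \<Longrightarrow> 0 \<le> \<phi> r" and le: "\<And>r. r > 0 \<Longrightarrow> \<phi> r \<le> K"
    and s: "s > 0" and t: "t > 0"
  shows "\<phi> (2 * s) - \<phi> (2 * s + t) \<le> 2 * t / s * K"
proof -
  have *: "real n * (\<phi> (a + real n * t) - \<phi> (a + real n * t + t)) \<le> \<phi> a - \<phi> (a + real n * t)"
    if "a > 0" for a n
  proof (induction n)
    case (Suc n)
    have "a + real n * t > 0"
      using that t by (simp add: add_pos_nonneg)
    from convex[OF this t]
    have "\<phi> (a + real (Suc n) * t) - \<phi> (a + real (Suc n) * t + t)
        \<le> \<phi> (a + real n * t) - \<phi> (a + real n * t + t)"
      by (simp add: algebra_simps)
    then have "real (Suc n) * (\<phi> (a + real (Suc n) * t) - \<phi> (a + real (Suc n) * t + t))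
        \<le> real (Suc n) * (\<phi> (a + real n * t) - \<phi> (a + real n * t + t))"
      by (intro mult_left_mono) auto
    also have "\<dots> \<le> \<phi> a - \<phi> (a + real (Suc n) * t)"
      using Suc by (simp add: algebra_simps)
    finally show ?case .
  qed simp
  define D where "D = \<phi> (2 * s) - \<phi> (2 * s + t)"
  have K: "K \<ge> 0"
    using nonneg[OF s] le[OF s] by simp
  have "D \<le> K"
    using nonneg[of "2 * s + t"] le[of "2 * s"] s t by (simp add: D_def)
  show ?thesis
  proof (cases "D \<le> 0 \<or> s < t")
    case True
    then show ?thesis
    proof
      assume "s < t"
      then have "1 * K \<le> 2 * t / s * K"
        using s t K by (intro mult_right_mono) (auto simp: field_simps)
      then show ?thesis using \<open>D \<le> K\<close> by (simp add: D_def)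
    next
      assume "D \<le> 0"
      moreover have "0 \<le> 2 * t / s * K"
        using K s t by simp
      ultimately show ?thesis by (simp add: D_def)
    qed
  next
    case False
    \<comment> \<open>As many steps as fit between \<open>s\<close> and \<open>2 * s\<close>, so
      that \<open>2 * s - n * t\<close> stays positive. Rounding down costs the factor 2 in
      \<open>s \<le> 2 * (n * t)\<close>.\<close>
    define n where "n = nat \<lfloor>s / t\<rfloor>"
    have "real n \<le> s / t" "s / t < real n + 1"
      using s t by (simp_all add: n_def)
    then have n: "real n * t \<le> s" "s < real n * t + t"
      using t by (simp_all add: field_simps)
    then have a: "2 * s - real n * t > 0"
      using s by simp
    have "n \<ge> 1"
      using n False by (cases n) auto
    then have "s \<le> 2 * (real n * t)"
      using n \<open>n \<ge> 1\<close> t mult_right_mono[of 1 "real n" t] by linarith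
    then have "s * D \<le> 2 * (real n * t) * D"
      using False by (intro mult_right_mono) auto
    also have "\<dots> = 2 * t * (real n * D)"
      by simp
    also have "real n * D \<le> K"
      using *[OF a, of n] nonneg[of "2 * s"] le[OF a] s by (simp add: D_def)
    finally have "s * D \<le> 2 * t * K"
      using t by simp
    then show ?thesis
      using s by (simp add: D_def field_simps)
  qed
qed

text \<open>Half of the exponential decay absorbs the power: \<open>x / a \<le> exp (x / a)\<close>,
  where \<open>a\<close> is large enough for \<open>\<gamma> * x / a \<le> c / 2 * x\<close>. Taking
  \<open>\<gamma> + 1\<close> in \<open>a\<close> keeps it positive when \<gamma> is 0.\<close>

lemma powr_mult_exp_bound:
  fixes \<gamma> c x :: real
  assumes \<gamma>: "\<gamma> \<ge> 0" and c: "c > 0" and x: "x \<ge> 0"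
  shows "x powr \<gamma> * exp (- c * x) \<le> (2 * (\<gamma> + 1) / c) powr \<gamma> * exp (- (c / 2) * x)"
proof (cases "x = 0")
  case False
  define a where "a = 2 * (\<gamma> + 1) / c"
  have a: "a > 0"
    using \<gamma> c by (simp add: a_def)
  have "x powr \<gamma> = (a * (x / a)) powr \<gamma>"
    using a by simp
  also have "\<dots> \<le> (a * exp (x / a)) powr \<gamma>"
    using a x \<gamma> order_trans[OF _ exp_ge_add_one_self[of "x / a"], of "x / a"]
    by (intro powr_mono2 mult_left_mono) auto
  also have "\<dots> = a powr \<gamma> * exp (\<gamma> * (x / a))"
    using a by (simp add: powr_mult exp_powr_real mult.commute)
  also have "\<gamma> * (x / a) = (c / 2 * x) * (\<gamma> / (\<gamma> + 1))"
    using \<gamma> c by (simp add: a_def field_simps)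
  also have "a powr \<gamma> * exp ((c / 2 * x) * (\<gamma> / (\<gamma> + 1))) \<le> a powr \<gamma> * exp ((c / 2 * x) * 1)"
    using \<gamma> c x by (intro mult_left_mono iffD2[OF exp_le_cancel_iff]) auto
  finally have "x powr \<gamma> * exp (- c * x) \<le> a powr \<gamma> * exp (c / 2 * x) * exp (- c * x)"
    by (intro mult_right_mono) auto
  also have "\<dots> = a powr \<gamma> * exp (- (c / 2) * x)"
    by (simp add: mult.assoc flip: exp_add)
  finally show ?thesis by (simp add: a_def)
qed simp

lemma powr_le_interpolate:
  fixes x q H :: real
  assumes "0 \<le> x" "x \<le> H" "q \<ge> 2"
  shows "x powr q \<le> H powr (q - 2) * x\<^sup>2"
proof (cases "x = 0")
  case False
  then have "x powr q = x powr (q - 2) * x powr 2"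
    using assms by (simp add: powr_diff)
  also have "\<dots> \<le> H powr (q - 2) * x powr 2"
    using assms by (intro mult_right_mono powr_mono2) auto
  finally show ?thesis
    using False assms by simp
qed (use assms in auto)

text \<open>Cutting \<open>[s, s + T]\<close> into \<open>n\<close> equal steps bounds the total
  increment by a constant times \<open>n powr (1 - e)\<close>, which tends to 0. So \<phi> is
  constant from \<open>s\<close> on, and its limit fixes the constant.\<close>

lemma vanishing_of_superlinear_increments:
  fixes \<phi> :: "real \<Rightarrow> real"
  assumes incr: "\<And>r t. r \<ge> s \<Longrightarrow> t > 0 \<Longrightarrow> \<bar>\<phi> r - \<phi> (r + t)\<bar> \<le> K * t powr e"
    and e: "e > 1" and lim: "(\<phi> \<longlongrightarrow> 0) at_top"
  shows "\<phi> s = 0"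
proof -
  have const: "\<phi> (s + T) = \<phi> s" if T: "T > 0" for T
  proof -
    have *: "\<bar>\<phi> s - \<phi> (s + T)\<bar> \<le> K * T powr e * real n powr (1 - e)" if n: "n > 0" for n :: nat
    proof -
      have step: "\<bar>\<phi> s - \<phi> (s + real j * (T / real n))\<bar> \<le> real j * (K * (T / real n) powr e)" for j
      proof (induction j)
        case (Suc j)
        have "\<bar>\<phi> (s + real j * (T / real n)) - \<phi> (s + real j * (T / real n) + T / real n)\<bar>
            \<le> K * (T / real n) powr e"
          using T n by (intro incr) auto
        then show ?case
          using Suc by (simp add: algebra_simps add_divide_distrib)
      qed simp
      have "\<bar>\<phi> s - \<phi> (s + T)\<bar> \<le> real n * (K * (T / real n) powr e)"
        using step[of n] n by simp
      also have "\<dots> = K * T powr e * real n powr (1 - e)"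
        using T n by (simp add: powr_divide powr_diff)
      finally show ?thesis .
    qed
    have "((\<lambda>n. real n powr (1 - e)) \<longlongrightarrow> 0) sequentially"
      using e by (intro tendsto_neg_powr filterlim_real_sequentially) auto
    then have "((\<lambda>n. K * T powr e * real n powr (1 - e)) \<longlongrightarrow> 0) sequentially"
      by (rule tendsto_mult_right_zero)
    then have "\<bar>\<phi> s - \<phi> (s + T)\<bar> \<le> 0"
      by (rule tendsto_lowerbound) (use * in \<open>auto intro: eventually_sequentiallyI[of 1]\<close>)
    then show ?thesis by simp
  qed
  have "(\<phi> \<longlongrightarrow> \<phi> s) at_top"
  proof (rule tendsto_eventually)
    show "\<forall>\<^sub>F r in at_top. \<phi> r = \<phi> s"
      using eventually_gt_at_top[of s]
    proof eventually_elim
      case (elim r)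
      then show ?case using const[of "r - s"] by simp
    qed
  qed
  then show ?thesis
    using lim tendsto_unique[of at_top \<phi>] by (simp add: trivial_limit_at_top_linorder)
qed

subsection \<open>The heat kernel as a coupling\<close>

locale heat_kernel_space =
  fixes M :: "'a::metric_space measure"
    and P :: "real \<Rightarrow> ('a \<Rightarrow> real) \<Rightarrow> 'a \<Rightarrow> real"
    and k :: "real \<Rightarrow> 'a \<Rightarrow> 'a \<Rightarrow> real"
    and dH dW \<kappa> :: real
  assumes metric_measure: "metric_measure_space M"
    and ahlfors: "ahlfors_regular M dH"
    and semigroup: "L2_semigroup M P"
    and extends: "extends_to_Lp M P"
    and conservative: "conservative M P"
    and kernel: "heat_kernel M P k"
    and sub_gaussian: "sub_gaussian_estimates M k dH dW"
    and bakry_emery: "weak_bakry_emery M P dW \<kappa>"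
    and \<kappa>_pos: "0 < \<kappa>"
begin

lemma sets_M [measurable_cong]: "sets M = sets borel"
  using metric_measure by (simp add: metric_measure_space_def)

lemma space_M [simp]: "space M = UNIV"
  using sets_eq_imp_space_eq[OF sets_M] by simp

lemma sets_UNIV [simp, measurable]: "UNIV \<in> sets M"
  and sets_ball [simp, measurable]: "ball x r \<in> sets M"
  by (simp_all add: sets_M)

lemma ball_finite: "emeasure M (ball x r) < \<infinity>"
proof (cases "r > 0")
  case True
  then obtain c where "emeasure M (ball x r) \<le> ennreal c"
    using ahlfors unfolding ahlfors_regular_def by blast
  then show ?thesis
    by (metis ennreal_less_top infinity_ennreal_def order_le_less_trans)
qed (simp add: ball_empty)

sublocale sigma_finite_measure M
proof
  show "\<exists>A. countable A \<and> A \<subseteq> sets M \<and> \<Union> A = space M \<and> (\<forall>a\<in>A. emeasure M a \<noteq> \<infinity>)"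
  proof (intro exI conjI)
    fix x :: 'a
    show "countable (range (\<lambda>n. ball x (real n)))" by simp
    show "range (\<lambda>n. ball x (real n)) \<subseteq> sets M" by auto
    show "\<Union> (range (\<lambda>n. ball x (real n))) = space M"
      by (auto simp: reals_Archimedean2)
    show "\<forall>a\<in>range (\<lambda>n. ball x (real n)). emeasure M a \<noteq> \<infinity>"
      using ball_finite by (auto simp: less_top)
  qed
qed

text \<open>The sublocale below makes \<open>M \<Otimes>\<^sub>M M\<close> an instance of \<open>sigma_finite_measure\<close> as well, which
  shadows these facts for \<open>M\<close>.\<close>

lemmas nn_integral_pair = nn_integral_fst
  and null_sets_pair = times_in_null_sets1 times_in_null_sets2

sublocale pair_sigma_finite M M ..

text \<open>The lower volume bound, at the radius where it equals a given \<open>B\<close>. Infinite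
  mass is what later makes 0 the only constant in L^p.\<close>

lemma emeasure_UNIV: "emeasure M UNIV = \<infinity>"
proof -
  from ahlfors obtain c1 where c1: "c1 > 0" "dH > 0"
    and le: "\<And>x r. r > 0 \<Longrightarrow> ennreal (c1 * r powr dH) \<le> emeasure M (ball x r)"
    unfolding ahlfors_regular_def by blast
  have "ennreal B \<le> emeasure M UNIV" if "B > 0" for B
  proof -
    have "ennreal B = ennreal (c1 * ((B / c1) powr (1 / dH)) powr dH)"
      using c1 that by (simp add: powr_powr)
    also have "\<dots> \<le> emeasure M (ball undefined ((B / c1) powr (1 / dH)))"
      using c1 that by (intro le) auto
    also have "\<dots> \<le> emeasure M UNIV"
      by (intro emeasure_mono) auto
    finally show ?thesis .
  qed
  from this[of "enn2real (emeasure M UNIV) + 1"] show ?thesis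
    by (cases "emeasure M UNIV" rule: ennreal_cases) (simp_all add: ennreal_le_iff)
qed

lemma kernel_measurable [measurable]:
  "t > 0 \<Longrightarrow> (\<lambda>z. k t (fst z) (snd z)) \<in> borel_measurable (M \<Otimes>\<^sub>M M)"
  using kernel unfolding heat_kernel_def case_prod_beta' by blast

lemma kernel_nonneg:
  assumes "t > 0"
  shows "AE z in M \<Otimes>\<^sub>M M. 0 \<le> k t (fst z) (snd z)"
proof -
  obtain c3 c4 c5 c6 where "c5 > 0" and *: "\<forall>t>0. AE (x, y) in M \<Otimes>\<^sub>M M.
        c5 * t powr (- dH / dW) * exp (- c6 * (dist x y powr dW / t) powr (1 / (dW - 1)))
          \<le> k t x y \<and>
        k t x y
          \<le> c3 * t powr (- dH / dW) * exp (- c4 * (dist x y powr dW / t) powr (1 / (dW - 1)))"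
    using sub_gaussian unfolding sub_gaussian_estimates_def by (elim conjE exE) (rule that)
  from *[rule_format, OF assms] show ?thesis
  proof (eventually_elim, clarsimp)
    fix x y
    assume "c5 * t powr - (dH / dW) * exp (- (c6 * (dist x y powr dW / t) powr (1 / (dW - 1))))
          \<le> k t x y"
    moreover have "0 \<le> c5 * t powr - (dH / dW) * exp (- (c6 * (dist x y powr dW / t) powr (1 / (dW - 1))))"
      using \<open>c5 > 0\<close> by simp
    ultimately show "0 \<le> k t x y" by linarith
  qed
qed

lemma P_Lp: "t > 0 \<Longrightarrow> q \<ge> 1 \<Longrightarrow> f \<in> Lp M q \<Longrightarrow> P t f \<in> Lp M q"
  using extends by (auto simp: extends_to_Lp_def Lp_contraction_def)

lemma P_symmetric:
  "t > 0 \<Longrightarrow> f \<in> Lp M 2 \<Longrightarrow> g \<in> Lp M 2 \<Longrightarrow> L2_inner M (P t f) g = L2_inner M f (P t g)"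
  using semigroup by (auto simp: L2_semigroup_def)

lemma P_kernel:
  "t > 0 \<Longrightarrow> f \<in> Lp M 2 \<Longrightarrow>
    AE x in M. integrable M (\<lambda>y. k t x y * f y) \<and> P t f x = (\<integral>y. k t x y * f y \<partial>M)"
  using kernel by (auto simp: heat_kernel_def)

text \<open>The operators on L^1 and L^\<infinity> are dual to each other; pair \<open>f\<close>
  with the constant 1, which conservativeness says is preserved.\<close>

lemma P_integral:
  assumes t: "t > 0" and f: "integrable M f"
  shows "(\<integral>x. P t f x \<partial>M) = (\<integral>x. f x \<partial>M)"
proof -
  have one: "(\<lambda>_. 1) \<in> Linf M"
    by (auto simp: Linf_def emeasure_UNIV intro!: le_less_trans[OF esssup_I[of _ _ 1]])
  have "AE x in M. P t (\<lambda>_. 1) x = 1"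
    using conservative t by (simp add: conservative_def)
  moreover have "P t (\<lambda>_. 1) \<in> Linf M"
    and *: "(\<integral>x. f x * P t (\<lambda>_. 1) x \<partial>M) = (\<integral>x. P t f x * 1 \<partial>M)"
    using extends t one f unfolding extends_to_Lp_def Lp_1_iff[symmetric] by blast+
  ultimately have "(\<integral>x. f x * P t (\<lambda>_. 1) x \<partial>M) = (\<integral>x. f x \<partial>M)"
    using f by (intro integral_cong_AE) (auto simp: Linf_def)
  then show ?thesis using * by simp
qed

text \<open>The heat kernel at time \<open>t\<close> is regarded as a measure on pairs of points; by
  conservativeness and symmetry, both of its marginals are \<open>M\<close>.\<close>

definition Q :: "real \<Rightarrow> ('a \<times> 'a) measure" where
  "Q t = density (M \<Otimes>\<^sub>M M) (\<lambda>z. ennreal (k t (fst z) (snd z)))"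

lemma sets_Q [measurable_cong, simp]: "sets (Q t) = sets (M \<Otimes>\<^sub>M M)"
  by (simp add: Q_def)

lemma space_Q [simp]: "space (Q t) = UNIV"
  by (simp add: Q_def space_pair_measure)

lemma nn_integral_Q:
  assumes "t > 0" "u \<in> borel_measurable (M \<Otimes>\<^sub>M M)"
  shows "(\<integral>\<^sup>+z. u z \<partial>Q t) = (\<integral>\<^sup>+z. ennreal (k t (fst z) (snd z)) * u z \<partial>(M \<Otimes>\<^sub>M M))"
  using assms unfolding Q_def by (intro nn_integral_density) auto

text \<open>Tonelli, followed by the kernel representation of \<open>P t\<close>. The latter is
  available on L^2, hence the finiteness of \<open>B\<close>.\<close>

lemma emeasure_Q_Times:
  assumes t: "t > 0" and [measurable]: "A \<in> sets M" "B \<in> sets M"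
    and fin: "emeasure M B < \<infinity>"
  shows "emeasure (Q t) (A \<times> B) = (\<integral>\<^sup>+x. ennreal (P t (indicator B) x) * indicator A x \<partial>M)"
proof -
  have [measurable]: "(\<lambda>(x, y). k t x y) \<in> borel_measurable (M \<Otimes>\<^sub>M M)"
    using kernel_measurable[OF t] by (simp add: case_prod_beta')
  have B: "indicator B \<in> Lp M 2"
    using fin by (intro Lp_indicator) auto
  have "emeasure (Q t) (A \<times> B) = (\<integral>\<^sup>+z. indicator (A \<times> B) z \<partial>Q t)"
    by simp
  also have "\<dots> = (\<integral>\<^sup>+z. ennreal (k t (fst z) (snd z)) * indicator (A \<times> B) z \<partial>(M \<Otimes>\<^sub>M M))"
    by (intro nn_integral_Q t) auto
  also have "\<dots> = (\<integral>\<^sup>+x. \<integral>\<^sup>+y. ennreal (k t x y) * indicator (A \<times> B) (x, y) \<partial>M \<partial>M)"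
    using nn_integral_pair[of "\<lambda>z. ennreal (k t (fst z) (snd z)) * indicator (A \<times> B) z" M] t
    by simp
  also have "\<dots> = (\<integral>\<^sup>+x. ennreal (P t (indicator B) x) * indicator A x \<partial>M)"
  proof (rule nn_integral_cong_AE)
    from P_kernel[OF t B] AE_pair[OF kernel_nonneg[OF t]]
    show "AE x in M. (\<integral>\<^sup>+y. ennreal (k t x y) * indicator (A \<times> B) (x, y) \<partial>M)
        = ennreal (P t (indicator B) x) * indicator A x"
    proof eventually_elim
      case (elim x)
      have "(\<integral>\<^sup>+y. ennreal (k t x y) * indicator (A \<times> B) (x, y) \<partial>M)
          = (\<integral>\<^sup>+y. indicator A x * ennreal (k t x y * indicator B y) \<partial>M)"
        by (intro nn_integral_cong) (auto simp: indicator_def)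
      also have "\<dots> = indicator A x * (\<integral>\<^sup>+y. ennreal (k t x y * indicator B y) \<partial>M)"
        by (intro nn_integral_cmult) (use elim in auto)
      also have "(\<integral>\<^sup>+y. ennreal (k t x y * indicator B y) \<partial>M) = ennreal (P t (indicator B) x)"
        using elim by (subst nn_integral_eq_integral) (auto elim!: eventually_mono)
      finally show ?case by (simp add: mult.commute)
    qed
  qed
  finally show ?thesis .
qed

lemma P_indicator_nonneg:
  assumes t: "t > 0" and [measurable]: "B \<in> sets M" and fin: "emeasure M B < \<infinity>"
  shows "AE x in M. 0 \<le> P t (indicator B) x"
proof -
  have B: "indicator B \<in> Lp M 2"
    using fin by (intro Lp_indicator) auto
  from P_kernel[OF t B] AE_pair[OF kernel_nonneg[OF t]]
  show ?thesis
  proof eventually_elim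
    case (elim x)
    then show ?case
      by (auto intro!: integral_nonneg_AE elim!: eventually_mono)
  qed
qed

lemma emeasure_Q_UNIV_Times_finite:
  assumes t: "t > 0" and B [measurable]: "B \<in> sets M" and fin: "emeasure M B < \<infinity>"
  shows "emeasure (Q t) (UNIV \<times> B) = emeasure M B"
proof -
  have i: "integrable M (indicator B :: 'a \<Rightarrow> real)"
    using fin by (simp add: integrable_indicator_iff)
  have "P t (indicator B) \<in> Lp M 1"
    using i by (intro P_Lp t) (auto simp: Lp_1_iff)
  then have Pi: "integrable M (P t (indicator B))"
    by (simp add: Lp_1_iff)
  have "emeasure (Q t) (UNIV \<times> B) = (\<integral>\<^sup>+x. ennreal (P t (indicator B) x) \<partial>M)"
    using emeasure_Q_Times[OF t _ B fin, of UNIV] by simp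
  also have "\<dots> = ennreal (\<integral>x. P t (indicator B) x \<partial>M)"
    by (intro nn_integral_eq_integral Pi P_indicator_nonneg t B fin)
  also have "\<dots> = emeasure M B"
    using fin by (simp add: P_integral[OF t i] emeasure_eq_ennreal_measure less_top)
  finally show ?thesis .
qed

text \<open>Symmetry is read off from the operator \<open>P t\<close> acting on indicators, rather
  than from pointwise symmetry of \<open>k\<close>.\<close>

lemma emeasure_Q_Times_commute:
  assumes t: "t > 0" and [measurable]: "A \<in> sets M" "B \<in> sets M"
    and fin: "emeasure M A < \<infinity>" "emeasure M B < \<infinity>"
  shows "emeasure (Q t) (A \<times> B) = emeasure (Q t) (B \<times> A)"
proof -
  have *: "emeasure (Q t) (A \<times> B) = ennreal (L2_inner M (P t (indicator B)) (indicator A))"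
    if [measurable]: "A \<in> sets M" "B \<in> sets M"
    and fin: "emeasure M A < \<infinity>" "emeasure M B < \<infinity>" for A B
  proof -
    have L: "indicator A \<in> Lp M 2" "indicator B \<in> Lp M 2"
      using fin by (auto intro!: Lp_indicator)
    have "emeasure (Q t) (A \<times> B) = (\<integral>\<^sup>+x. ennreal (P t (indicator B) x * indicator A x) \<partial>M)"
      unfolding emeasure_Q_Times[OF t that(1,2) fin(2)]
      by (intro nn_integral_cong) (auto simp: indicator_def)
    also have "\<dots> = ennreal (L2_inner M (P t (indicator B)) (indicator A))"
      unfolding L2_inner_def using P_indicator_nonneg[OF t that(2) fin(2)]
      by (intro nn_integral_eq_integral L2_integrable_mult P_Lp t L)
         (auto elim!: eventually_mono)
    finally show ?thesis .
  qed
  have L: "indicator A \<in> Lp M 2" "indicator B \<in> Lp M 2"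
    using fin by (auto intro!: Lp_indicator)
  show ?thesis
    using P_symmetric[OF t L] assms by (simp add: * L2_inner_def mult.commute)
qed

text \<open>Continuity from below along balls exhausting the space, which carries identities over
  from sets of finite measure.\<close>

lemma SUP_emeasure_Times_ball:
  assumes [measurable]: "A \<in> sets M"
  shows "(SUP n. emeasure (Q t) (A \<times> ball x (real n))) = emeasure (Q t) (A \<times> UNIV)"
    and "(SUP n. emeasure (Q t) (ball x (real n) \<times> A)) = emeasure (Q t) (UNIV \<times> A)"
    and "(SUP n. emeasure M (A \<inter> ball x (real n))) = emeasure M A"
proof -
  have U: "(\<Union>n. ball x (real n)) = UNIV"
    by (auto simp: reals_Archimedean2)
  have "(SUP n. emeasure (Q t) (A \<times> ball x (real n))) = emeasure (Q t) (\<Union>n. A \<times> ball x (real n))"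
    by (intro SUP_emeasure_incseq) (auto simp: incseq_def)
  also have "(\<Union>n. A \<times> ball x (real n)) = A \<times> UNIV"
    using U by auto
  finally show "(SUP n. emeasure (Q t) (A \<times> ball x (real n))) = emeasure (Q t) (A \<times> UNIV)" .
  have "(SUP n. emeasure (Q t) (ball x (real n) \<times> A)) = emeasure (Q t) (\<Union>n. ball x (real n) \<times> A)"
    by (intro SUP_emeasure_incseq) (auto simp: incseq_def)
  also have "(\<Union>n. ball x (real n) \<times> A) = UNIV \<times> A"
    using U by auto
  finally show "(SUP n. emeasure (Q t) (ball x (real n) \<times> A)) = emeasure (Q t) (UNIV \<times> A)" .
  have "(SUP n. emeasure M (A \<inter> ball x (real n))) = emeasure M (\<Union>n. A \<inter> ball x (real n))"
    by (intro SUP_emeasure_incseq) (auto simp: incseq_def)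
  also have "(\<Union>n. A \<inter> ball x (real n)) = A"
    using U by auto
  finally show "(SUP n. emeasure M (A \<inter> ball x (real n))) = emeasure M A" .
qed

lemma SUP_emeasure_Times_Int_ball:
  assumes [measurable]: "A \<in> sets M"
  shows "(SUP n. emeasure (Q t) (UNIV \<times> (A \<inter> ball x (real n)))) = emeasure (Q t) (UNIV \<times> A)"
    and "(SUP n. emeasure (Q t) ((A \<inter> ball x (real n)) \<times> UNIV)) = emeasure (Q t) (A \<times> UNIV)"
proof -
  have U: "(\<Union>n. ball x (real n)) = UNIV"
    by (auto simp: reals_Archimedean2)
  have "(SUP n. emeasure (Q t) (UNIV \<times> (A \<inter> ball x (real n))))
      = emeasure (Q t) (\<Union>n. UNIV \<times> (A \<inter> ball x (real n)))"
    by (intro SUP_emeasure_incseq) (auto simp: incseq_def)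
  also have "(\<Union>n. UNIV \<times> (A \<inter> ball x (real n))) = UNIV \<times> A"
    using U by auto
  finally show "(SUP n. emeasure (Q t) (UNIV \<times> (A \<inter> ball x (real n)))) = emeasure (Q t) (UNIV \<times> A)" .
  have "(SUP n. emeasure (Q t) ((A \<inter> ball x (real n)) \<times> UNIV))
      = emeasure (Q t) (\<Union>n. (A \<inter> ball x (real n)) \<times> UNIV)"
    by (intro SUP_emeasure_incseq) (auto simp: incseq_def)
  also have "(\<Union>n. (A \<inter> ball x (real n)) \<times> UNIV) = A \<times> UNIV"
    using U by auto
  finally show "(SUP n. emeasure (Q t) ((A \<inter> ball x (real n)) \<times> UNIV)) = emeasure (Q t) (A \<times> UNIV)" .
qed

lemma emeasure_Q_UNIV_Times:
  assumes t: "t > 0" and [measurable]: "A \<in> sets M"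
  shows "emeasure (Q t) (UNIV \<times> A) = emeasure M A"
proof -
  have "emeasure (Q t) (UNIV \<times> A) = (SUP n. emeasure (Q t) (UNIV \<times> (A \<inter> ball undefined (real n))))"
    using assms by (simp add: SUP_emeasure_Times_Int_ball)
  also have "\<dots> = (SUP n. emeasure M (A \<inter> ball undefined (real n)))"
    using le_less_trans[OF emeasure_mono[of "A \<inter> ball undefined _" "ball undefined _" M] ball_finite]
    by (intro SUP_cong refl emeasure_Q_UNIV_Times_finite t) auto
  also have "\<dots> = emeasure M A"
    using assms by (simp add: SUP_emeasure_Times_ball)
  finally show ?thesis .
qed

text \<open>The first marginal is reduced to the second: exhaust the free factor by balls and swap
  the two finite factors by symmetry. A second exhaustion removes the finiteness of
  \<open>A\<close>.\<close>

lemma emeasure_Q_Times_UNIV: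
  assumes t: "t > 0" and A [measurable]: "A \<in> sets M"
  shows "emeasure (Q t) (A \<times> UNIV) = emeasure M A"
proof -
  have fin: "emeasure (Q t) (A \<times> UNIV) = emeasure M A" 
    if [measurable]: "A \<in> sets M" and "emeasure M A < \<infinity>" for A
  proof -
    have "emeasure (Q t) (A \<times> UNIV) = (SUP n. emeasure (Q t) (A \<times> ball undefined (real n)))"
      using that by (simp add: SUP_emeasure_Times_ball)
    also have "\<dots> = (SUP n. emeasure (Q t) (ball undefined (real n) \<times> A))"
      using that by (intro SUP_cong refl emeasure_Q_Times_commute t ball_finite) auto
    also have "\<dots> = emeasure M A"
      using that by (simp add: SUP_emeasure_Times_ball emeasure_Q_UNIV_Times t)
    finally show ?thesis .
  qed
  have "emeasure (Q t) (A \<times> UNIV) = (SUP n. emeasure (Q t) ((A \<inter> ball undefined (real n)) \<times> UNIV))"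
    using assms by (simp add: SUP_emeasure_Times_Int_ball)
  also have "\<dots> = (SUP n. emeasure M (A \<inter> ball undefined (real n)))"
    using le_less_trans[OF emeasure_mono[of "A \<inter> ball undefined _" "ball undefined _" M] ball_finite]
    by (intro SUP_cong refl fin) auto
  also have "\<dots> = emeasure M A"
    using assms by (simp add: SUP_emeasure_Times_ball)
  finally show ?thesis .
qed

lemma distr_Q:
  assumes t: "t > 0"
  shows "distr (Q t) M fst = M" "distr (Q t) M snd = M"
proof -
  show "distr (Q t) M fst = M" "distr (Q t) M snd = M"
    using t by (auto intro!: measure_eqI simp: vimage_fst vimage_snd emeasure_distr sets_M emeasure_Q_Times_UNIV emeasure_Q_UNIV_Times)
qed

lemma nn_integral_Q_marginal:
  assumes "t > 0" "u \<in> borel_measurable M"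
  shows "(\<integral>\<^sup>+z. u (fst z) \<partial>Q t) = (\<integral>\<^sup>+x. u x \<partial>M)" "(\<integral>\<^sup>+z. u (snd z) \<partial>Q t) = (\<integral>\<^sup>+x. u x \<partial>M)"
  using assms nn_integral_distr[of fst "Q t" M u] nn_integral_distr[of snd "Q t" M u]
  by (simp_all add: distr_Q)

lemma integrable_Q_marginal:
  fixes u :: "'a \<Rightarrow> real"
  assumes "t > 0" "integrable M u"
  shows "integrable (Q t) (\<lambda>z. u (fst z))" "integrable (Q t) (\<lambda>z. u (snd z))"
  using assms integrable_distr[of fst "Q t" M u] integrable_distr[of snd "Q t" M u]
  by (simp_all add: distr_Q)

lemma integral_Q_marginal:
  fixes u :: "'a \<Rightarrow> real"
  assumes "t > 0" "u \<in> borel_measurable M"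
  shows "(\<integral>z. u (fst z) \<partial>Q t) = (\<integral>x. u x \<partial>M)" "(\<integral>z. u (snd z) \<partial>Q t) = (\<integral>x. u x \<partial>M)"
  using assms integral_distr[of fst "Q t" M u] integral_distr[of snd "Q t" M u]
  by (simp_all add: distr_Q)

lemma Q_Lp_2:
  assumes t: "t > 0" and f: "f \<in> Lp M 2"
  shows "(\<lambda>z. f (fst z)) \<in> Lp (Q t) 2" "(\<lambda>z. f (snd z)) \<in> Lp (Q t) 2"
proof -
  have [measurable]: "f \<in> borel_measurable M"
    using f by (rule Lp_measurable)
  show "(\<lambda>z. f (fst z)) \<in> Lp (Q t) 2" "(\<lambda>z. f (snd z)) \<in> Lp (Q t) 2"
    using f integrable_Q_marginal[OF t, of "\<lambda>x. (f x)\<^sup>2"] by (auto simp: Lp_2_iff)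
qed

text \<open>Since both marginals are \<open>M\<close>, the two factors lie in L^2 of the coupling;
  this gives the integrability that Fubini requires.\<close>

lemma integral_Q_mult:
  assumes t: "t > 0" and f: "f \<in> Lp M 2" and g: "g \<in> Lp M 2"
  shows "(\<integral>z. f (fst z) * g (snd z) \<partial>Q t) = L2_inner M f (P t g)"
proof -
  have [measurable]: "f \<in> borel_measurable M" "g \<in> borel_measurable M"
    using f g by (auto dest: Lp_measurable)
  have [measurable]: "(\<lambda>(x, y). k t x y) \<in> borel_measurable (M \<Otimes>\<^sub>M M)"
    using kernel_measurable[OF t] by (simp add: case_prod_beta')
  note [measurable] = kernel_measurable[OF t]
  have "integrable (Q t) (\<lambda>z. f (fst z) * g (snd z))"
    by (intro L2_integrable_mult Q_Lp_2 t f g)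
  then have i: "integrable (M \<Otimes>\<^sub>M M) (\<lambda>z. k t (fst z) (snd z) * (f (fst z) * g (snd z)))"
    unfolding Q_def using kernel_nonneg[OF t] by (subst (asm) integrable_density) auto
  have "(\<integral>z. f (fst z) * g (snd z) \<partial>Q t)
      = (\<integral>z. k t (fst z) (snd z) * (f (fst z) * g (snd z)) \<partial>(M \<Otimes>\<^sub>M M))"
    unfolding Q_def using kernel_nonneg[OF t] by (subst integral_density) auto
  also have "\<dots> = (\<integral>x. \<integral>y. k t x y * (f x * g y) \<partial>M \<partial>M)"
    using integral_fst'[OF i] by simp
  also have "\<dots> = (\<integral>x. f x * P t g x \<partial>M)"
  proof (rule integral_cong_AE)
    show "(\<lambda>x. f x * P t g x) \<in> borel_measurable M"
      using Lp_measurable[OF P_Lp[OF t _ g]] by auto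
    show "AE x in M. (\<integral>y. k t x y * (f x * g y) \<partial>M) = f x * P t g x"
      using P_kernel[OF t g]
    proof eventually_elim
      case (elim x)
      have "(\<integral>y. k t x y * (f x * g y) \<partial>M) = (\<integral>y. f x * (k t x y * g y) \<partial>M)"
        by (simp add: ac_simps)
      then show ?case using elim by simp
    qed
  qed measurable
  finally show ?thesis by (simp add: L2_inner_def)
qed

subsection \<open>Energies and correlations\<close>

text \<open>The double integral inside the Besov seminorm, before the \<open>p\<close>-th root is
  taken, written against the coupling.\<close>

definition energy :: "real \<Rightarrow> real \<Rightarrow> ('a \<Rightarrow> real) \<Rightarrow> ennreal" where
  "energy p t f = (\<integral>\<^sup>+z. ennreal (\<bar>f (fst z) - f (snd z)\<bar> powr p) \<partial>Q t)"

lemma energy_eq_besov_integral: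
  assumes t: "t > 0" and [measurable]: "f \<in> borel_measurable M"
  shows "(\<integral>\<^sup>+ y. \<integral>\<^sup>+ x. ennreal (\<bar>f x - f y\<bar> powr p * k t x y) \<partial>M \<partial>M) = energy p t f"
proof -
  note [measurable] = kernel_measurable[OF t]
  have "energy p t f = (\<integral>\<^sup>+z. ennreal (k t (fst z) (snd z)) *
      ennreal (\<bar>f (fst z) - f (snd z)\<bar> powr p) \<partial>(M \<Otimes>\<^sub>M M))"
    unfolding energy_def using t by (intro nn_integral_Q) auto
  also have "\<dots> = (\<integral>\<^sup>+z. ennreal (\<bar>f (fst z) - f (snd z)\<bar> powr p * k t (fst z) (snd z)) \<partial>(M \<Otimes>\<^sub>M M))"
    by (intro nn_integral_cong, subst ennreal_mult') (simp_all add: mult.commute)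
  also have "\<dots> = (\<integral>\<^sup>+ y. \<integral>\<^sup>+ x. ennreal (\<bar>f x - f y\<bar> powr p * k t x y) \<partial>M \<partial>M)"
    by (subst nn_integral_snd[symmetric]) auto
  finally show ?thesis by simp
qed

text \<open>Expand the product. The two diagonal terms are integrals against the marginals, and the
  two mixed terms agree by symmetry of \<open>P t\<close>.\<close>

lemma integral_Q_differences:
  assumes t: "t > 0" and f: "f \<in> Lp M 2" and h: "h \<in> Lp M 2"
  shows "integrable (Q t) (\<lambda>z. (f (fst z) - f (snd z)) * (h (fst z) - h (snd z)))"
    and "(\<integral>z. (f (fst z) - f (snd z)) * (h (fst z) - h (snd z)) \<partial>Q t)
      = 2 * (L2_inner M f h - L2_inner M f (P t h))"
proof -
  have [measurable]: "f \<in> borel_measurable M" "h \<in> borel_measurable M"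
    using f h by (auto dest: Lp_measurable)
  note Q = Q_Lp_2[OF t f] Q_Lp_2[OF t h]
  have eq: "(f (fst z) - f (snd z)) * (h (fst z) - h (snd z))
      = f (fst z) * h (fst z) - f (fst z) * h (snd z) - h (fst z) * f (snd z) + f (snd z) * h (snd z)" for z
    by (simp add: algebra_simps)
  note i = L2_integrable_mult[OF Q(1) Q(3)] L2_integrable_mult[OF Q(1) Q(4)]
    L2_integrable_mult[OF Q(3) Q(2)] L2_integrable_mult[OF Q(2) Q(4)]
  show "integrable (Q t) (\<lambda>z. (f (fst z) - f (snd z)) * (h (fst z) - h (snd z)))"
    unfolding eq using i by auto
  have "(\<integral>z. (f (fst z) - f (snd z)) * (h (fst z) - h (snd z)) \<partial>Q t)
      = L2_inner M f h - L2_inner M f (P t h) - L2_inner M h (P t f) + L2_inner M f h"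
    unfolding eq using i integral_Q_marginal[OF t, of "\<lambda>x. f x * h x"]
    by (simp add: integral_Q_mult[OF t] f h L2_inner_def)
  also have "L2_inner M h (P t f) = L2_inner M f (P t h)"
    using P_symmetric[OF t f h] by (simp add: L2_inner_def mult.commute)
  finally show "(\<integral>z. (f (fst z) - f (snd z)) * (h (fst z) - h (snd z)) \<partial>Q t)
      = 2 * (L2_inner M f h - L2_inner M f (P t h))"
    by simp
qed

lemma energy_2:
  assumes t: "t > 0" and f: "f \<in> Lp M 2"
  shows "energy 2 t f = ennreal (2 * (L2_inner M f f - L2_inner M f (P t f)))"
    and "L2_inner M f (P t f) \<le> L2_inner M f f"
proof -
  have "energy 2 t f = (\<integral>\<^sup>+z. ennreal ((f (fst z) - f (snd z)) * (f (fst z) - f (snd z))) \<partial>Q t)"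
    by (simp add: energy_def power2_eq_square)
  also have "\<dots> = ennreal (2 * (L2_inner M f f - L2_inner M f (P t f)))"
    using integral_Q_differences[OF t f f] by (subst nn_integral_eq_integral) auto
  finally show "energy 2 t f = ennreal (2 * (L2_inner M f f - L2_inner M f (P t f)))" .
  have "0 \<le> (\<integral>z. (f (fst z) - f (snd z)) * (f (fst z) - f (snd z)) \<partial>Q t)"
    by (intro integral_nonneg_AE) auto
  then show "L2_inner M f (P t f) \<le> L2_inner M f f"
    by (simp add: integral_Q_differences[OF t f f])
qed

lemma inner_P_P:
  assumes s: "s > 0" and t: "t > 0" and f: "f \<in> Lp M 2" and g: "g \<in> Lp M 2"
  shows "L2_inner M (P s f) (P t g) = L2_inner M f (P (s + t) g)"
proof -
  have L: "P t g \<in> Lp M 2" "P s (P t g) \<in> Lp M 2" "P (s + t) g \<in> Lp M 2"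
    using s t g by (auto intro!: P_Lp)
  have "AE x in M. P (s + t) g x = P s (P t g) x"
    using semigroup s t g by (auto simp: L2_semigroup_def)
  then have "L2_inner M f (P s (P t g)) = L2_inner M f (P (s + t) g)"
    unfolding L2_inner_def using L f
    by (intro integral_cong_AE) (auto intro!: borel_measurable_times dest: Lp_measurable)
  then show ?thesis
    using P_symmetric[OF s f L(1)] by simp
qed

context
  fixes g :: "'a \<Rightarrow> real"
  assumes g: "g \<in> Lp M 2"
begin

text \<open>Splitting the time in half exhibits the correlation as the squared norm of
  \<open>P (r / 2) g\<close>. The upper bound is nonnegativity of the quadratic energy.\<close>

lemma correlation_bounds:
  assumes "r > 0"
  shows "0 \<le> L2_inner M g (P r g)" "L2_inner M g (P r g) \<le> L2_inner M g g"
proof -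
  have "L2_inner M g (P r g) = L2_inner M (P (r / 2) g) (P (r / 2) g)"
    using inner_P_P[of "r / 2" "r / 2" g g] assms g by simp
  also have "0 \<le> \<dots>"
    unfolding L2_inner_def by (intro integral_nonneg_AE) auto
  finally show "0 \<le> L2_inner M g (P r g)" .
  show "L2_inner M g (P r g) \<le> L2_inner M g g"
    using energy_2(2)[OF assms g] .
qed

text \<open>The second difference of the correlation is the squared L^2 distance of
  \<open>P (r / 2) g\<close> and \<open>P (r / 2 + t) g\<close>.\<close>

lemma correlation_convex:
  assumes r: "r > 0" and t: "t > 0"
  shows "2 * L2_inner M g (P (r + t) g) \<le> L2_inner M g (P r g) + L2_inner M g (P (r + 2 * t) g)"
proof -
  let ?u = "P (r / 2) g" and ?v = "P (r / 2 + t) g"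
  have L: "?u \<in> Lp M 2" "?v \<in> Lp M 2"
    using r t g by (auto intro!: P_Lp)
  have "0 \<le> (\<integral>x. (?u x - ?v x)\<^sup>2 \<partial>M)"
    by (intro integral_nonneg_AE) auto
  also have "\<dots> = (\<integral>x. ?u x * ?u x - 2 * (?u x * ?v x) + ?v x * ?v x \<partial>M)"
    by (intro Bochner_Integration.integral_cong refl) (simp add: power2_eq_square algebra_simps)
  also have "\<dots> = L2_inner M ?u ?u - 2 * L2_inner M ?u ?v + L2_inner M ?v ?v"
    using L2_integrable_mult[OF L(1) L(1)] L2_integrable_mult[OF L] L2_integrable_mult[OF L(2) L(2)]
    by (simp add: L2_inner_def)
  also have "\<dots> = L2_inner M g (P r g) - 2 * L2_inner M g (P (r + t) g) + L2_inner M g (P (r + 2 * t) g)"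
    using r t g by (simp add: inner_P_P add.assoc[symmetric]) (simp add: add_ac)
  finally show ?thesis by simp
qed

text \<open>By the semigroup law the energy is twice the decrement of the correlation of
  \<open>g\<close> from time \<open>2 * s\<close> to \<open>2 * s + t\<close>, to which the bound
  for convex functions applies.\<close>

lemma energy_2_P:
  assumes s: "s > 0" and t: "t > 0"
  shows "energy 2 t (P s g) \<le> ennreal (4 * t / s * L2_inner M g g)"
proof -
  have L: "P s g \<in> Lp M 2"
    using s g by (auto intro!: P_Lp)
  have "L2_inner M (P s g) (P t (P s g)) = L2_inner M (P t (P s g)) (P s g)"
    by (simp add: L2_inner_def mult.commute)
  also have "\<dots> = L2_inner M (P s g) (P (t + s) g)"
    using inner_P_P[OF t s L g] .
  also have "\<dots> = L2_inner M g (P (2 * s + t) g)"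
    using inner_P_P[of s "t + s" g g] s t g by (simp add: algebra_simps)
  finally have "L2_inner M (P s g) (P t (P s g)) = L2_inner M g (P (2 * s + t) g)" .
  moreover have "L2_inner M (P s g) (P s g) = L2_inner M g (P (2 * s) g)"
    using inner_P_P[of s s g g] s t g by simp
  ultimately have "energy 2 t (P s g)
      = ennreal (2 * (L2_inner M g (P (2 * s) g) - L2_inner M g (P (2 * s + t) g)))"
    using energy_2[OF t L] by simp
  also have "\<dots> \<le> ennreal (4 * t / s * L2_inner M g g)"
    using convex_decrement_bound[of "\<lambda>r. L2_inner M g (P r g)" "L2_inner M g g", OF
        correlation_convex correlation_bounds s t] 
    by (intro ennreal_leI) simp
  finally show ?thesis .
qed

end

section \<open>Heat kernel estimates and the energy bounds drawn from them\<close>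

lemma kernel_bounds:
  obtains c3 c4 c5 c6 where "c3 > 0" "c4 > 0" "c5 > 0" "c6 > 0"
    "\<And>t. t > 0 \<Longrightarrow> AE z in M \<Otimes>\<^sub>M M.
      c5 * t powr (- dH / dW) * exp (- c6 * (dist (fst z) (snd z) powr dW / t) powr (1 / (dW - 1)))
        \<le> k t (fst z) (snd z)"
    "\<And>t. t > 0 \<Longrightarrow> AE z in M \<Otimes>\<^sub>M M. k t (fst z) (snd z)
        \<le> c3 * t powr (- dH / dW) * exp (- c4 * (dist (fst z) (snd z) powr dW / t) powr (1 / (dW - 1)))"
proof -
  obtain c3 c4 c5 c6 where c: "c3 > 0" "c4 > 0" "c5 > 0" "c6 > 0"
    and *: "\<forall>t>0. AE (x, y) in M \<Otimes>\<^sub>M M.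
        c5 * t powr (- dH / dW) * exp (- c6 * (dist x y powr dW / t) powr (1 / (dW - 1)))
          \<le> k t x y \<and>
        k t x y
          \<le> c3 * t powr (- dH / dW) * exp (- c4 * (dist x y powr dW / t) powr (1 / (dW - 1)))"
    using sub_gaussian unfolding sub_gaussian_estimates_def by (elim conjE exE) (rule that)
  show thesis
  proof (rule that[OF c])
    fix t :: real
    assume "t > 0"
    from *[rule_format, OF this]
    show "AE z in M \<Otimes>\<^sub>M M.
      c5 * t powr (- dH / dW) * exp (- c6 * (dist (fst z) (snd z) powr dW / t) powr (1 / (dW - 1)))
        \<le> k t (fst z) (snd z)"
      by (rule eventually_mono) (simp add: case_prod_beta)
    from *[rule_format, OF \<open>t > 0\<close>]
    show "AE z in M \<Otimes>\<^sub>M M. k t (fst z) (snd z)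
        \<le> c3 * t powr (- dH / dW) * exp (- c4 * (dist (fst z) (snd z) powr dW / t) powr (1 / (dW - 1)))"
      by (rule eventually_mono) (simp add: case_prod_beta)
  qed
qed

lemma dW: "dW \<ge> 2"
  using sub_gaussian by (simp add: sub_gaussian_estimates_def)

lemma dH: "dH > 0"
  using ahlfors by (simp add: ahlfors_regular_def)

text \<open>Dropping the exponential from the upper estimate leaves a bound on the kernel uniform in
  space, so the correlation is at most this bound times the square of the integral of
  \<open>g\<close>.\<close>

lemma correlation_decay:
  assumes g: "g \<in> Lp M 2" and nonneg: "\<And>x. 0 \<le> g x" and fin: "integrable M g"
  shows "((\<lambda>r. L2_inner M g (P r g)) \<longlongrightarrow> 0) at_top"
proof -
  obtain c3 c4 where c: "c3 > 0" "c4 > 0" and le: "\<And>t. t > 0 \<Longrightarrow> AE z in M \<Otimes>\<^sub>M M. k t (fst z) (snd z)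
        \<le> c3 * t powr (- dH / dW) * exp (- c4 * (dist (fst z) (snd z) powr dW / t) powr (1 / (dW - 1)))"
    by (rule kernel_bounds) (rule that)
  have [measurable]: "g \<in> borel_measurable M"
    using g by (rule Lp_measurable)
  let ?I = "\<integral>x. g x \<partial>M"
  have I: "?I \<ge> 0"
    using nonneg by simp
  have bound: "L2_inner M g (P r g) \<le> c3 * ?I\<^sup>2 * r powr (- dH / dW)" if r: "r > 0" for r
  proof -
    note [measurable] = kernel_measurable[OF r]
    have "ennreal (L2_inner M g (P r g)) = (\<integral>\<^sup>+z. ennreal (g (fst z) * g (snd z)) \<partial>Q r)"
      unfolding integral_Q_mult[OF r g g, symmetric]
      using nonneg by (intro nn_integral_eq_integral[symmetric] L2_integrable_mult Q_Lp_2 r g) auto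
    also have "\<dots> = (\<integral>\<^sup>+z. ennreal (k r (fst z) (snd z)) * ennreal (g (fst z) * g (snd z)) \<partial>(M \<Otimes>\<^sub>M M))"
      by (intro nn_integral_Q r) auto
    also have "\<dots> \<le> (\<integral>\<^sup>+z. ennreal (c3 * r powr (- dH / dW)) * (ennreal (g (fst z)) * ennreal (g (snd z))) \<partial>(M \<Otimes>\<^sub>M M))"
    proof (rule nn_integral_mono_AE, use le[OF r] in eventually_elim)
      case (elim z)
      have "k r (fst z) (snd z) \<le> c3 * r powr (- dH / dW) *
          exp (- c4 * (dist (fst z) (snd z) powr dW / r) powr (1 / (dW - 1)))"
        by (rule elim)
      also have "\<dots> \<le> c3 * r powr (- dH / dW) * 1"
        using c by (intro mult_left_mono) auto
      finally show ?case
        using nonneg by (auto intro!: mult_right_mono ennreal_leI simp: ennreal_mult')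
    qed
    also have "\<dots> = ennreal (c3 * r powr (- dH / dW)) * (\<integral>\<^sup>+z. ennreal (g (fst z)) * ennreal (g (snd z)) \<partial>(M \<Otimes>\<^sub>M M))"
      by (intro nn_integral_cmult) auto
    also have "(\<integral>\<^sup>+z. ennreal (g (fst z)) * ennreal (g (snd z)) \<partial>(M \<Otimes>\<^sub>M M))
        = (\<integral>\<^sup>+x. \<integral>\<^sup>+y. ennreal (g x) * ennreal (g y) \<partial>M \<partial>M)"
      using nn_integral_pair[of "\<lambda>z. ennreal (g (fst z)) * ennreal (g (snd z))" M] by simp
    also have "\<dots> = ennreal ?I * ennreal ?I"
      using nn_integral_eq_integral[OF fin] nonneg by (simp add: nn_integral_cmult nn_integral_multc)
    finally have "ennreal (L2_inner M g (P r g)) \<le> ennreal (c3 * ?I\<^sup>2 * r powr (- dH / dW))"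
      using c I by (simp add: ennreal_mult'[symmetric] ennreal_mult''[symmetric] power2_eq_square mult_ac)
    then show ?thesis
      using c I by (simp add: ennreal_le_iff)
  qed
  show ?thesis
  proof (rule tendsto_sandwich)
    show "\<forall>\<^sub>F r in at_top. 0 \<le> L2_inner M g (P r g)"
      using eventually_gt_at_top[of 0] by eventually_elim (rule correlation_bounds[OF g])
    show "\<forall>\<^sub>F r in at_top. L2_inner M g (P r g) \<le> c3 * ?I\<^sup>2 * r powr (- dH / dW)"
      using eventually_gt_at_top[of 0] by eventually_elim (rule bound)
    have "((\<lambda>r. r powr (- dH / dW)) \<longlongrightarrow> 0) at_top"
      using dH dW by (intro tendsto_neg_powr filterlim_ident) auto
    then show "((\<lambda>r. c3 * ?I\<^sup>2 * r powr (- dH / dW)) \<longlongrightarrow> 0) at_top"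
      by (rule tendsto_mult_right_zero)
  qed simp
qed

text \<open>In the upper estimate at time \<open>t\<close>, half of the exponential decay absorbs
  the power of the distance. What is left has the shape of the lower estimate at a suitable multiple
  of \<open>t\<close>.\<close>

lemma kernel_comparison:
  assumes \<beta>: "\<beta> \<ge> 0"
  obtains C c where "C > 0" "c > 0"
    "\<And>t. t > 0 \<Longrightarrow> AE z in M \<Otimes>\<^sub>M M.
      dist (fst z) (snd z) powr \<beta> * k t (fst z) (snd z) \<le> C * t powr (\<beta> / dW) * k (c * t) (fst z) (snd z)"
proof -
  obtain c3 c4 c5 c6 where c3: "c3 > 0" and c4: "c4 > 0" and c5: "c5 > 0" and c6: "c6 > 0"
    and lower: "\<And>t. t > 0 \<Longrightarrow> AE z in M \<Otimes>\<^sub>M M.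
      c5 * t powr (- dH / dW) * exp (- c6 * (dist (fst z) (snd z) powr dW / t) powr (1 / (dW - 1)))
        \<le> k t (fst z) (snd z)"
    and upper: "\<And>t. t > 0 \<Longrightarrow> AE z in M \<Otimes>\<^sub>M M. k t (fst z) (snd z)
        \<le> c3 * t powr (- dH / dW) * exp (- c4 * (dist (fst z) (snd z) powr dW / t) powr (1 / (dW - 1)))"
    by (rule kernel_bounds) (rule that)
  \<comment> \<open>Chosen so that passing from \<open>t\<close> to \<open>c * t\<close> turns the
    rate \<open>c6\<close> of the lower estimate into \<open>c4 / 2\<close>.\<close>
  define c where "c = (2 * c6 / c4) powr (dW - 1)"
  \<comment> \<open>With \<open>Z\<close> the quantity in the exponent at time \<open>t\<close>,
    \<open>Z powr \<gamma>\<close> is \<open>d powr \<beta> / t powr (\<beta> / dW)\<close> off the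
    diagonal.\<close>
  define \<gamma> where "\<gamma> = \<beta> * (dW - 1) / dW"
  define K where "K = (2 * (\<gamma> + 1) / c4) powr \<gamma>"
  have c: "c > 0"
    using c4 c6 by (simp add: c_def)
  have \<gamma>: "\<gamma> \<ge> 0"
    using \<beta> dW by (simp add: \<gamma>_def)
  have K: "K > 0"
    using \<gamma> c4 by (simp add: K_def)
  have "c powr (1 / (dW - 1)) = 2 * c6 / c4"
    using c4 c6 dW by (simp add: c_def powr_powr)
  then have c_root: "c6 / c powr (1 / (dW - 1)) = c4 / 2"
    using c4 c6 by simp
  show thesis
  proof (rule that[of "c3 * K * c powr (dH / dW) / c5" c])
    show "c > 0" "c3 * K * c powr (dH / dW) / c5 > 0"
      using c c3 c5 K by auto
    fix t :: real
    assume t: "t > 0"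
    then have ct: "c * t > 0" using c by simp
    show "AE z in M \<Otimes>\<^sub>M M. dist (fst z) (snd z) powr \<beta> * k t (fst z) (snd z)
        \<le> c3 * K * c powr (dH / dW) / c5 * t powr (\<beta> / dW) * k (c * t) (fst z) (snd z)"
      using upper[OF t] lower[OF ct] kernel_nonneg[OF t] kernel_nonneg[OF ct]
    proof eventually_elim
      case (elim z)
      define d where "d = dist (fst z) (snd z)"
      define Z where "Z = (d powr dW / t) powr (1 / (dW - 1))"
      show ?case
      proof (cases "d = 0")
        \<comment> \<open>The left side is 0 on the diagonal even for \<beta> = 0, because
          \<open>0 powr 0\<close> is 0.\<close>
        case True
        then show ?thesis
          using elim c c3 c5 K by (simp add: d_def)
      next
        case False
        then have d: "d > 0" by (simp add: d_def)
        have Z: "Z \<ge> 0" by (simp add: Z_def)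
        have "Z powr \<gamma> = (d powr dW / t) powr (\<beta> / dW)"
          using dW by (simp add: Z_def \<gamma>_def powr_powr)
        also have "\<dots> = d powr \<beta> / t powr (\<beta> / dW)"
          using d t dW by (simp add: powr_divide powr_powr)
        finally have d_eq: "d powr \<beta> = t powr (\<beta> / dW) * Z powr \<gamma>"
          using t by simp
        have "(d powr dW / (c * t)) powr (1 / (dW - 1)) = Z / c powr (1 / (dW - 1))"
          using c t d unfolding Z_def by (simp add: powr_divide powr_mult)
        then have "c6 * (d powr dW / (c * t)) powr (1 / (dW - 1)) = c6 / c powr (1 / (dW - 1)) * Z"
          by simp
        then have Z_eq: "- c6 * (d powr dW / (c * t)) powr (1 / (dW - 1)) = - (c4 / 2) * Z"
          unfolding c_root by simp
        have "c powr (dH / dW) * (c * t) powr (- dH / dW) = t powr (- dH / dW)"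
          using c t by (simp add: powr_mult powr_minus field_simps)
        then have lower': "t powr (- dH / dW) * exp (- (c4 / 2) * Z) \<le> c powr (dH / dW) / c5 * k (c * t) (fst z) (snd z)"
          using mult_left_mono[OF elim(2), of "c powr (dH / dW) / c5"] c c5
          unfolding d_def[symmetric] Z_eq by (simp add: mult.assoc[symmetric])
        have "d powr \<beta> * k t (fst z) (snd z)
            \<le> t powr (\<beta> / dW) * Z powr \<gamma> * (c3 * t powr (- dH / dW) * exp (- c4 * Z))"
          unfolding d_eq using elim(1) t by (intro mult_left_mono) (auto simp: Z_def d_def)
        also have "\<dots> = t powr (\<beta> / dW) * c3 * t powr (- dH / dW) * (Z powr \<gamma> * exp (- c4 * Z))"
          by (simp only: mult_ac)
        also have "\<dots> \<le> t powr (\<beta> / dW) * c3 * t powr (- dH / dW) * (K * exp (- (c4 / 2) * Z))"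
          using powr_mult_exp_bound[OF \<gamma> c4 Z] c3 unfolding K_def by (intro mult_left_mono) auto
        also have "\<dots> = (t powr (\<beta> / dW) * c3 * K) * (t powr (- dH / dW) * exp (- (c4 / 2) * Z))"
          by (simp only: mult_ac)
        also have "\<dots> \<le> (t powr (\<beta> / dW) * c3 * K) * (c powr (dH / dW) / c5 * k (c * t) (fst z) (snd z))"
          using lower' c3 K by (intro mult_left_mono) auto
        finally show ?thesis
          by (simp add: d_def mult_ac)
      qed
    qed
  qed
qed

lemma AE_pair_marginal:
  assumes "AE x in M. R x"
  shows "AE z in M \<Otimes>\<^sub>M M. R (fst z) \<and> R (snd z)"
proof -
  obtain N where N: "N \<in> null_sets M" and R: "{x \<in> space M. \<not> R x} \<subseteq> N"
    using assms by (auto simp: eventually_ae_filter)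
  show ?thesis
  proof (rule AE_I')
    show "(N \<times> UNIV) \<union> (UNIV \<times> N) \<in> null_sets (M \<Otimes>\<^sub>M M)"
      using N by (intro null_sets.Un null_sets_pair) auto
    show "{z \<in> space (M \<Otimes>\<^sub>M M). \<not> (R (fst z) \<and> R (snd z))} \<subseteq> N \<times> UNIV \<union> UNIV \<times> N"
      using R by (auto simp: mem_Times_iff)
  qed
qed

text \<open>Of the \<open>q\<close> factors of the difference, \<open>q - 2\<close> are estimated by
  Hoelder continuity and yield the power \<open>\<kappa> * (q - 2)\<close> of the distance, which
  the kernel comparison trades for a power of \<open>t\<close>. The other two form a quadratic
  energy. Both estimates improve as \<open>S\<close> grows, so the constant is uniform for
  \<open>S \<ge> s\<close>.\<close>

lemma energy_P:
  assumes q: "q \<ge> 2" and g: "g \<in> Lp M 2" "g \<in> Linf M" and s: "s > 0"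
  obtains C where "C \<ge> 0"
    "\<And>S t. S \<ge> s \<Longrightarrow> t > 0 \<Longrightarrow> energy q t (P S g) \<le> ennreal (C * t powr (1 + \<kappa> * (q - 2) / dW))"
proof -
  define \<beta> where "\<beta> = \<kappa> * (q - 2)"
  have \<beta>: "\<beta> \<ge> 0"
    using q \<kappa>_pos by (simp add: \<beta>_def)
  obtain C c where C: "C > 0" and c: "c > 0" and comparison: "\<And>t. t > 0 \<Longrightarrow> AE z in M \<Otimes>\<^sub>M M.
      dist (fst z) (snd z) powr \<beta> * k t (fst z) (snd z) \<le> C * t powr (\<beta> / dW) * k (c * t) (fst z) (snd z)"
    by (rule kernel_comparison[OF \<beta>]) (rule that)
  obtain B where B: "B > 0" and BE: "\<forall>t>0. \<forall>g\<in>Linf M. \<exists>h. (AE x in M. P t g x = h x) \<and>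
        (\<forall>x y. \<bar>h x - h y\<bar> \<le> B * (dist x y powr \<kappa> / t powr (\<kappa> / dW)) * Linf_norm M g)"
    using bakry_emery unfolding weak_bakry_emery_def by blast
  \<comment> \<open>A Hoelder constant valid for \<open>P S g\<close> at every
    \<open>S \<ge> s\<close>.\<close>
  define H where "H = B / s powr (\<kappa> / dW) * Linf_norm M g"
  define I where "I = L2_inner M g g"
  have I: "I \<ge> 0"
    unfolding I_def L2_inner_def by (intro integral_nonneg_AE) auto
  have H: "H \<ge> 0"
    using B by (simp add: H_def Linf_norm_def)
  show thesis
  proof (rule that[of "H powr (q - 2) * C * (4 * c / s * I)"])
    show "H powr (q - 2) * C * (4 * c / s * I) \<ge> 0"
      using C c s I by auto
    fix S t :: real
    assume S: "S \<ge> s" and t: "t > 0"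
    then have S0: "S > 0" and ct: "c * t > 0"
      using s c by auto
    note [measurable] = kernel_measurable[OF t] kernel_measurable[OF ct]
    let ?v = "P S g"
    have [measurable]: "?v \<in> borel_measurable M"
      using P_Lp[OF S0 _ g(1)] by (auto dest: Lp_measurable)
    \<comment> \<open>The Hoelder representative. It equals \<open>P S g\<close> only almost
      everywhere, which suffices for almost every pair of points.\<close>
    obtain h where h: "AE x in M. ?v x = h x"
      and h_le: "\<And>x y. \<bar>h x - h y\<bar> \<le> B * (dist x y powr \<kappa> / S powr (\<kappa> / dW)) * Linf_norm M g"
      using BE S0 g(2) by blast
    have h_le': "\<bar>h x - h y\<bar> \<le> H * dist x y powr \<kappa>" for x y
    proof -
      have "B * (dist x y powr \<kappa> / S powr (\<kappa> / dW)) * Linf_norm M g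
          \<le> B * (dist x y powr \<kappa> / s powr (\<kappa> / dW)) * Linf_norm M g"
        using B S s \<kappa>_pos dW
        by (intro mult_right_mono mult_left_mono divide_left_mono powr_mono2)
           (auto simp: Linf_norm_def)
      then show ?thesis
        using h_le[of x y] by (simp add: H_def mult_ac)
    qed
    have "energy q t ?v = (\<integral>\<^sup>+z. ennreal (k t (fst z) (snd z)) *
        ennreal (\<bar>?v (fst z) - ?v (snd z)\<bar> powr q) \<partial>(M \<Otimes>\<^sub>M M))"
      unfolding energy_def using t by (intro nn_integral_Q) auto
    also have "\<dots> \<le> (\<integral>\<^sup>+z. ennreal (H powr (q - 2) * C * t powr (\<beta> / dW)) *
        (ennreal (k (c * t) (fst z) (snd z)) * ennreal (\<bar>?v (fst z) - ?v (snd z)\<bar> powr 2)) \<partial>(M \<Otimes>\<^sub>M M))"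
    proof (rule nn_integral_mono_AE)
      show "AE z in M \<Otimes>\<^sub>M M. ennreal (k t (fst z) (snd z)) * ennreal (\<bar>?v (fst z) - ?v (snd z)\<bar> powr q)
        \<le> ennreal (H powr (q - 2) * C * t powr (\<beta> / dW)) *
          (ennreal (k (c * t) (fst z) (snd z)) * ennreal (\<bar>?v (fst z) - ?v (snd z)\<bar> powr 2))"
        using comparison[OF t] kernel_nonneg[OF t] kernel_nonneg[OF ct] AE_pair_marginal[OF h]
      proof eventually_elim
        case (elim z)
        define Y where "Y = \<bar>?v (fst z) - ?v (snd z)\<bar>"
        define d where "d = dist (fst z) (snd z)"
        have Y: "0 \<le> Y" "Y \<le> H * d powr \<kappa>"
          using elim h_le'[of "fst z" "snd z"] by (auto simp: Y_def d_def)
        have "k t (fst z) (snd z) * Y powr q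
            \<le> k t (fst z) (snd z) * ((H * d powr \<kappa>) powr (q - 2) * Y\<^sup>2)"
          using elim Y q by (intro mult_left_mono powr_le_interpolate) auto
        also have "\<dots> = H powr (q - 2) * Y\<^sup>2 * (d powr \<beta> * k t (fst z) (snd z))"
          using H by (simp add: powr_mult powr_powr \<beta>_def mult_ac)
        also have "\<dots> \<le> H powr (q - 2) * Y\<^sup>2 * (C * t powr (\<beta> / dW) * k (c * t) (fst z) (snd z))"
          using elim(1) by (intro mult_left_mono) (auto simp: d_def)
        also have "\<dots> = H powr (q - 2) * C * t powr (\<beta> / dW) * (k (c * t) (fst z) (snd z) * Y powr 2)"
          using Y by simp
        finally show ?case
          using elim C by (simp add: ennreal_leI Y_def flip: ennreal_mult)
      qed
    qed
    also have "\<dots> = ennreal (H powr (q - 2) * C * t powr (\<beta> / dW)) *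
        (\<integral>\<^sup>+z. ennreal (k (c * t) (fst z) (snd z)) * ennreal (\<bar>?v (fst z) - ?v (snd z)\<bar> powr 2) \<partial>(M \<Otimes>\<^sub>M M))"
      by (intro nn_integral_cmult) auto
    also have "(\<integral>\<^sup>+z. ennreal (k (c * t) (fst z) (snd z)) * ennreal (\<bar>?v (fst z) - ?v (snd z)\<bar> powr 2) \<partial>(M \<Otimes>\<^sub>M M))
        = energy 2 (c * t) ?v"
      unfolding energy_def using ct by (intro nn_integral_Q[symmetric]) auto
    also have "\<dots> \<le> ennreal (4 * (c * t) / S * I)"
      unfolding I_def by (intro energy_2_P g S0 ct)
    also have "\<dots> \<le> ennreal (4 * (c * t) / s * I)"
      using S S0 s c t I by (intro ennreal_leI mult_right_mono divide_left_mono) auto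
    also have "ennreal (H powr (q - 2) * C * t powr (\<beta> / dW)) * ennreal (4 * (c * t) / s * I)
        = ennreal (H powr (q - 2) * C * (4 * c / s * I) * t powr (1 + \<kappa> * (q - 2) / dW))"
      using C c t s I by (simp add: powr_add \<beta>_def mult_ac flip: ennreal_mult')
    finally show "energy q t ?v \<le> ennreal (H powr (q - 2) * C * (4 * c / s * I) * t powr (1 + \<kappa> * (q - 2) / dW))"
      by (simp add: mult_left_mono)
  qed
qed

text \<open>A pair contributes only if one of its points lies in \<open>A\<close>, and such pairs
  have mass at most \<open>2 * measure M A\<close> since the marginals are \<open>M\<close>. On this
  finite mass a higher exponent controls a lower one.\<close>

lemma energy_lower_exponent:
  assumes t: "t > 0" and [measurable]: "f \<in> borel_measurable M" "A \<in> sets M"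
    and fin: "emeasure M A < \<infinity>" and supp: "\<And>x. x \<notin> A \<Longrightarrow> f x = 0"
    and r: "0 < r" "r \<le> s" and C: "C \<ge> 0" and le: "energy s t f \<le> ennreal (C * t powr b)"
  shows "energy r t f \<le> ennreal ((2 * measure M A + C) * t powr (b * r / s))"
proof -
  define \<tau> where "\<tau> = t powr (b * r / s)"
  \<comment> \<open>\<open>w\<^sup>r \<le> 1 + w\<^sup>s\<close> at \<open>w = x t\<^bsup>-b/s\<^esup>\<close>, in place of Hoelder's inequality\<close>
  have bound: "x powr r \<le> \<tau> * (1 + t powr (- b) * x powr s)" if "x \<ge> 0" for x
  proof (cases "x = 0")
    case False
    define w where "w = x * t powr (- b / s)"
    have w: "w > 0"
      using False that t by (simp add: w_def)
    have "w powr r \<le> 1 + w powr s"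
    proof (cases "w \<le> 1")
      case True
      then show ?thesis
        using w r powr_le1[of r w] powr_ge_zero[of w s] by linarith
    next
      case False
      then show ?thesis
        using r powr_mono[of r s w] by linarith
    qed
    moreover have "x powr r = \<tau> * w powr r"
    proof -
      have "\<tau> * w powr r = x powr r * (\<tau> * t powr (- b / s * r))"
        using that by (simp only: w_def powr_mult powr_powr powr_ge_zero mult_ac)
      also have "\<tau> * t powr (- b / s * r) = 1"
        using t by (simp add: \<tau>_def flip: powr_add)
      finally show ?thesis by simp
    qed
    moreover have "t powr (- b) * x powr s = w powr s"
      using t r that by (simp add: w_def powr_mult powr_powr)
    ultimately show ?thesis
      using t by (simp add: \<tau>_def)
  qed (use t in \<open>auto simp: \<tau>_def\<close>)
  have "energy r t f \<le> (\<integral>\<^sup>+z. ennreal \<tau> * (indicator A (fst z) + indicator A (snd z)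
      + ennreal (t powr (- b)) * ennreal (\<bar>f (fst z) - f (snd z)\<bar> powr s)) \<partial>Q t)"
    unfolding energy_def
  proof (intro nn_integral_mono)
    fix z
    show "ennreal (\<bar>f (fst z) - f (snd z)\<bar> powr r) \<le> ennreal \<tau> * (indicator A (fst z) + indicator A (snd z)
      + ennreal (t powr (- b)) * ennreal (\<bar>f (fst z) - f (snd z)\<bar> powr s))"
    proof (cases "fst z \<in> A \<or> snd z \<in> A")
      case True
      have "ennreal (\<bar>f (fst z) - f (snd z)\<bar> powr r)
          \<le> ennreal (\<tau> * (1 + t powr (- b) * \<bar>f (fst z) - f (snd z)\<bar> powr s))"
        by (intro ennreal_leI bound) auto
      also have "\<dots> = ennreal \<tau> * (1 + ennreal (t powr (- b)) * ennreal (\<bar>f (fst z) - f (snd z)\<bar> powr s))"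
        by (simp add: ennreal_mult' \<tau>_def)
      also have "\<dots> \<le> ennreal \<tau> * (indicator A (fst z) + indicator A (snd z)
      + ennreal (t powr (- b)) * ennreal (\<bar>f (fst z) - f (snd z)\<bar> powr s))"
        using True by (intro mult_left_mono add_right_mono) (auto simp: indicator_def)
      finally show ?thesis .
    qed (use supp r in auto)
  qed
  also have "\<dots> = ennreal \<tau> * (emeasure M A + emeasure M A + ennreal (t powr (- b)) * energy s t f)"
    using nn_integral_Q_marginal[OF t, of "indicator A"]
    unfolding energy_def by (simp add: nn_integral_cmult nn_integral_add)
  also have "\<dots> \<le> ennreal \<tau> * (emeasure M A + emeasure M A + ennreal (t powr (- b)) * ennreal (C * t powr b))"
    using le by (intro mult_left_mono add_left_mono) auto
  also have "\<dots> = ennreal ((2 * measure M A + C) * \<tau>)"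
    using fin C t by (simp add: emeasure_eq_ennreal_measure less_top \<tau>_def powr_minus mult_ac
      flip: ennreal_mult' ennreal_plus)
  finally show ?thesis by (simp add: \<tau>_def)
qed

subsection \<open>Triviality of Besov classes\<close>

lemma energy_contraction:
  assumes "\<And>x y. \<bar>f x - f y\<bar> \<le> \<bar>h x - h y\<bar>" "p \<ge> 0"
  shows "energy p t f \<le> energy p t h"
  unfolding energy_def using assms
  by (intro nn_integral_mono ennreal_leI powr_mono2) auto

lemma energy_antimono_exponent:
  assumes "\<And>x y. \<bar>f x - f y\<bar> \<le> 1" "0 < r" "r \<le> s"
  shows "energy s t f \<le> energy r t f"
  unfolding energy_def
proof (intro nn_integral_mono ennreal_leI)
  fix z
  show "\<bar>f (fst z) - f (snd z)\<bar> powr s \<le> \<bar>f (fst z) - f (snd z)\<bar> powr r"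
    using assms(1)[of "fst z" "snd z"] assms by (intro powr_mono') auto
qed

lemma bounded_finite_support:
  assumes meas: "g \<in> borel_measurable M" and bounds: "\<And>x. 0 \<le> g x" "\<And>x. g x \<le> 1"
    and fin: "emeasure M {x. g x \<noteq> 0} < \<infinity>"
  shows "g \<in> Lp M 2" "g \<in> Linf M" "integrable M g"
proof -
  note [measurable] = meas
  have A: "{x. g x \<noteq> 0} \<in> sets M"
    using measurable_sets[OF meas, of "- {0}"] by (simp add: vimage_def)
  then have i: "integrable M (indicator {x. g x \<noteq> 0} :: 'a \<Rightarrow> real)"
    using fin by (simp add: integrable_indicator_iff)
  show "integrable M g"
    by (rule Bochner_Integration.integrable_bound[OF i meas]) (use bounds in \<open>auto simp: indicator_def\<close>)
  have "(g x)\<^sup>2 \<le> 1" for x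
    using bounds[of x] by (simp add: power_le_one)
  then have "integrable M (\<lambda>x. (g x)\<^sup>2)"
    by (intro Bochner_Integration.integrable_bound[OF i]) (auto simp: indicator_def)
  then show "g \<in> Lp M 2"
    using meas by (simp add: Lp_2_iff)
  have "esssup M (\<lambda>x. ennreal \<bar>g x\<bar>) \<le> 1"
    using bounds by (intro esssup_I) (auto simp: ennreal_le_1)
  then show "g \<in> Linf M"
    using meas by (auto simp: Linf_def intro: le_less_trans)
qed

text \<open>The correlation decrement at \<open>r\<close> is half the pairing of the differences of
  \<open>g\<close> with those of \<open>P r g\<close>. Pairing the energy rate of \<open>g\<close>
  for exponent \<open>p\<close> with that of \<open>P r g\<close> for the conjugate exponent makes
  the decrement superlinear in \<open>t\<close>, so the correlation vanishes identically.\<close>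

lemma vanishing_of_small_energy:
  assumes meas [measurable]: "g \<in> borel_measurable M" and bounds: "\<And>x. 0 \<le> g x" "\<And>x. g x \<le> 1"
    and fin: "emeasure M {x. g x \<noteq> 0} < \<infinity>"
    and p: "1 < p" "p \<le> 2" and C: "C \<ge> 0"
    and le: "\<And>t. t > 0 \<Longrightarrow> energy p t g \<le> ennreal (C * t powr a)"
    and a: "a > 1 - (2 - p) * (\<kappa> / dW)" "a > 0"
  shows "AE x in M. g x = 0"
proof -
  note L = bounded_finite_support[OF meas bounds fin]
  \<comment> \<open>The conjugate exponent; \<open>p \<le> 2\<close> makes it at least 2, the range
    covered by \<open>energy_P\<close>.\<close>
  define q where "q = p / (p - 1)"
  have q: "q \<ge> 2" "1 / p + 1 / q = 1"
    using p by (simp_all add: q_def field_simps)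
  define b where "b = 1 + \<kappa> * (q - 2) / dW"
  define e where "e = a / p + b / q"
  \<comment> \<open>The assumed lower bound on \<open>a\<close> amounts precisely to
    \<open>e > 1\<close>: the \<kappa> terms of \<open>a / p\<close> and \<open>b / q\<close> cancel
    at the threshold.\<close>
  have "b / q = (1 - 1 / p) + (\<kappa> / dW) * (2 / p - 1)"
    using p dW by (simp add: b_def q_def field_simps)
  moreover have "a / p > (1 - (2 - p) * (\<kappa> / dW)) / p"
    using a p by (intro divide_strict_right_mono) auto
  moreover have "(1 - (2 - p) * (\<kappa> / dW)) / p = 1 / p - (\<kappa> / dW) * (2 / p - 1)"
    using p dW by (simp add: field_simps)
  ultimately have e: "e > 1"
    by (simp add: e_def)
  define \<phi> where "\<phi> r = L2_inner M g (P r g)" for r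
  have zero: "\<phi> s = 0" if s: "s > 0" for s
  proof -
    obtain C' where C': "C' \<ge> 0" and le': "\<And>S t. S \<ge> s \<Longrightarrow> t > 0 \<Longrightarrow>
        energy q t (P S g) \<le> ennreal (C' * t powr b)"
      using energy_P[OF q(1) L(1,2) s] unfolding b_def by metis
    show ?thesis
    proof (rule vanishing_of_superlinear_increments[OF _ e, where \<phi> = \<phi> and K = "C + C'"])
      show "(\<phi> \<longlongrightarrow> 0) at_top"
        unfolding \<phi>_def using L bounds by (intro correlation_decay) auto
      fix r t :: real
      assume r: "r \<ge> s" and t: "t > 0"
      define h where "h = P r g"
      have h: "h \<in> Lp M 2"
        unfolding h_def using r s L by (intro P_Lp) auto
      then have [measurable]: "h \<in> borel_measurable M"
        by (rule Lp_measurable)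
      have "L2_inner M (P t g) (P r g) = L2_inner M g (P (r + t) g)"
        using inner_P_P[of t r g g] r s t L by (simp add: add.commute)
      \<comment> \<open>Symmetry moves \<open>P t\<close> onto \<open>h\<close>, which gives the
        right side the form of the pairing of differences of \<open>g\<close> and
        \<open>h\<close>.\<close>
      then have diff: "\<phi> r - \<phi> (r + t) = L2_inner M g h - L2_inner M g (P t h)"
        using P_symmetric[OF t L(1) h] by (simp add: \<phi>_def h_def)
      let ?X = "\<lambda>z. \<bar>g (fst z) - g (snd z)\<bar>" and ?Y = "\<lambda>z. \<bar>h (fst z) - h (snd z)\<bar>"
      \<comment> \<open>Each factor is first rescaled by the rate of its own energy, so that both
        terms become bounded in \<open>t\<close>; undoing the rescaling produces
        \<open>t powr e\<close>. The weights \<open>1 / p\<close> and \<open>1 / q\<close> are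
        bounded by 1.\<close>
      have young: "x * y \<le> t powr e * (t powr (- a) * x powr p + t powr (- b) * y powr q)"
        if "x \<ge> 0" "y \<ge> 0" for x y
      proof -
        have "t powr e * (t powr (- a / p) * t powr (- b / q)) = 1"
          using t by (simp add: e_def flip: powr_add)
        then have eq: "x * y = t powr e * ((t powr (- a / p) * x) * (t powr (- b / q) * y))"
          by (simp add: mult_ac)
        have "(t powr (- a / p) * x) * (t powr (- b / q) * y)
            \<le> (t powr (- a / p) * x) powr p / p + (t powr (- b / q) * y) powr q / q"
          using p q that by (intro Youngs_inequality) auto
        also have "\<dots> \<le> (t powr (- a / p) * x) powr p / 1 + (t powr (- b / q) * y) powr q / 1"
          using p q by (intro add_mono divide_left_mono) auto
        also have "\<dots> = t powr (- a) * x powr p + t powr (- b) * y powr q"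
          using p q that by (simp add: powr_mult powr_powr)
        finally show ?thesis
          unfolding eq by (intro mult_left_mono) auto
      qed
      have "ennreal (\<bar>\<integral>z. (g (fst z) - g (snd z)) * (h (fst z) - h (snd z)) \<partial>Q t\<bar>)
          \<le> ennreal (\<integral>z. \<bar>(g (fst z) - g (snd z)) * (h (fst z) - h (snd z))\<bar> \<partial>Q t)"
        by (intro ennreal_leI integral_abs_bound)
      also have "\<dots> = (\<integral>\<^sup>+z. ennreal (\<bar>(g (fst z) - g (snd z)) * (h (fst z) - h (snd z))\<bar>) \<partial>Q t)"
        by (intro nn_integral_eq_integral[symmetric] integrable_abs integral_Q_differences t L h) auto
      also have "\<dots> \<le> (\<integral>\<^sup>+z. ennreal (t powr e) * (ennreal (t powr (- a)) * ennreal (?X z powr p)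
          + ennreal (t powr (- b)) * ennreal (?Y z powr q)) \<partial>Q t)"
      proof (rule nn_integral_mono)
        fix z
        have "ennreal (\<bar>(g (fst z) - g (snd z)) * (h (fst z) - h (snd z))\<bar>)
            \<le> ennreal (t powr e * (t powr (- a) * ?X z powr p + t powr (- b) * ?Y z powr q))"
          unfolding abs_mult by (intro ennreal_leI young) auto
        then show "ennreal (\<bar>(g (fst z) - g (snd z)) * (h (fst z) - h (snd z))\<bar>)
            \<le> ennreal (t powr e) * (ennreal (t powr (- a)) * ennreal (?X z powr p)
          + ennreal (t powr (- b)) * ennreal (?Y z powr q))"
          by (simp add: ennreal_mult')
      qed
      also have "\<dots> = ennreal (t powr e) * (ennreal (t powr (- a)) * energy p t g
          + ennreal (t powr (- b)) * energy q t h)"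
        unfolding energy_def by (simp add: nn_integral_cmult nn_integral_add)
      also have "\<dots> \<le> ennreal (t powr e) * (ennreal (t powr (- a)) * ennreal (C * t powr a)
          + ennreal (t powr (- b)) * ennreal (C' * t powr b))"
        using le[OF t] le'[OF r t] unfolding h_def by (intro mult_left_mono add_mono) auto
      also have "\<dots> = ennreal ((C + C') * t powr e)"
        using C C' t by (simp add: powr_minus mult_ac flip: ennreal_mult' ennreal_plus)
      finally have "\<bar>\<integral>z. (g (fst z) - g (snd z)) * (h (fst z) - h (snd z)) \<partial>Q t\<bar> \<le> (C + C') * t powr e"
        using C C' by (subst (asm) ennreal_le_iff) auto
      then have "2 * \<bar>\<phi> r - \<phi> (r + t)\<bar> \<le> (C + C') * t powr e"
        unfolding diff integral_Q_differences(2)[OF t L(1) h] by linarith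
      then show "\<bar>\<phi> r - \<phi> (r + t)\<bar> \<le> (C + C') * t powr e"
        by (rule order_trans[rotated]) simp
    qed
  qed
  have I: "L2_inner M g g \<ge> 0"
    unfolding L2_inner_def by (intro integral_nonneg_AE) auto
  have "2 * L2_inner M g g \<le> C * t powr a" if t: "t > 0" for t
  proof -
    \<comment> \<open>As the correlation at time \<open>t\<close> is 0, the quadratic energy is
      twice the squared norm of \<open>g\<close>, whatever \<open>t\<close> is. It is also at most
      the \<open>p\<close>-energy, because differences of \<open>g\<close> are at most 1.\<close>
    have "ennreal (2 * L2_inner M g g) = energy 2 t g"
      using energy_2(1)[OF t L(1)] zero[OF t] by (simp add: \<phi>_def)
    also have "\<dots> \<le> energy p t g"
    proof (rule energy_antimono_exponent)
      show "\<bar>g x - g y\<bar> \<le> 1" for x y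
        using bounds[of x] bounds[of y] by linarith
    qed (use p in auto)
    also have "\<dots> \<le> ennreal (C * t powr a)"
      by (rule le[OF t])
    finally show ?thesis
      using C by (subst (asm) ennreal_le_iff) auto
  qed
  then have "\<forall>\<^sub>F t in at_right 0. 2 * L2_inner M g g \<le> C * t powr a"
    by (auto simp: eventually_at_filter)
  moreover have "((\<lambda>t. C * t powr a) \<longlongrightarrow> 0) (at_right 0)"
  proof (rule tendsto_mult_right_zero)
    have "((\<lambda>t. t powr a) \<longlongrightarrow> 0 powr a) (at_right 0)"
      using a by (intro tendsto_powr') (auto simp: eventually_at_filter)
    then show "((\<lambda>t. t powr a) \<longlongrightarrow> 0) (at_right 0)"
      using a by simp
  qed
  ultimately have "2 * L2_inner M g g \<le> 0"
    by (intro tendsto_lowerbound) auto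
  then have "(\<integral>x. g x * g x \<partial>M) = 0"
    using I unfolding L2_inner_def by linarith
  then have "AE x in M. g x * g x = 0"
    using L2_integrable_mult[OF L(1) L(1)] by (subst (asm) integral_nonneg_eq_0_iff_AE) auto
  then show ?thesis by (rule eventually_mono) auto
qed

lemma finite_superlevel:
  assumes f: "f \<in> Lp M p" and p: "p > 0" and \<epsilon>: "\<epsilon> > 0"
  shows "emeasure M {x. f x > \<epsilon>} < \<infinity>"
proof -
  have [measurable]: "f \<in> borel_measurable M"
    using f by (rule Lp_measurable)
  have "emeasure M {x. f x > \<epsilon>} \<le> emeasure M {x \<in> space M. \<bar>f x\<bar> powr p \<ge> \<epsilon> powr p}"
    using \<epsilon> p by (intro emeasure_mono) (auto intro: powr_mono2)
  also have "\<dots> \<le> (1 / \<epsilon> powr p) * (\<integral>x. \<bar>f x\<bar> powr p \<partial>M)"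
    using f \<epsilon> by (intro integral_Markov_inequality) (auto simp: Lp_iff)
  also have "\<dots> < \<infinity>" by simp
  finally show ?thesis .
qed

text \<open>Truncation keeps the energy bound and supplies a bounded function with support of finite
  measure. For \<open>p > 2\<close> that support allows descending to exponent 2; for
  \<open>p \<le> 2\<close> the vanishing criterion applies almost directly.\<close>

lemma clip_vanishes:
  assumes f: "f \<in> Lp M p" and C: "C \<ge> 0"
    and le: "\<And>t. t > 0 \<Longrightarrow> energy p t f \<le> ennreal (C * t powr a)"
    and a: "1 \<le> p \<and> p \<le> 2 \<and> a > 1 - (2 - p) * (\<kappa> / dW) \<or> 2 \<le> p \<and> a > p / 2"
    and \<kappa>: "\<kappa> \<le> dW / 2" and \<epsilon>: "\<epsilon> > 0"
  shows "AE x in M. clip \<epsilon> (f x) = 0"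
proof -
  have [measurable]: "f \<in> borel_measurable M"
    using f by (rule Lp_measurable)
  define g where "g = (\<lambda>x. clip \<epsilon> (f x))"
  have p: "p \<ge> 1" using a by auto
  have meas [measurable]: "g \<in> borel_measurable M"
    unfolding g_def clip_def by measurable
  have bounds: "0 \<le> g x" "g x \<le> 1" for x
    by (auto simp: g_def clip_def)
  have supp: "{x. g x \<noteq> 0} = {x. f x > \<epsilon>}"
    by (auto simp: g_def clip_def)
  have fin: "emeasure M {x. g x \<noteq> 0} < \<infinity>"
    unfolding supp using p by (intro finite_superlevel[OF f _ \<epsilon>]) auto
  have diff: "\<bar>g x - g y\<bar> \<le> 1" for x y
    using bounds[of x] bounds[of y] by linarith
  have le_g: "energy p t g \<le> ennreal (C * t powr a)" if "t > 0" for t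
    using p by (intro order_trans[OF energy_contraction le] that) (auto simp: g_def clip_def)
  define \<rho> where "\<rho> = \<kappa> / dW"
  have \<rho>: "0 < \<rho>" "\<rho> \<le> 1 / 2"
    using \<kappa> \<kappa>_pos dW by (auto simp: \<rho>_def field_simps)
  have "AE x in M. g x = 0"
  proof (cases "p \<le> 2")
    case False
    then have p: "p \<ge> 2" and a: "a > p / 2" using a by auto
    show ?thesis
    proof (rule vanishing_of_small_energy[OF meas bounds fin, of 2])
      fix t :: real
      assume t: "t > 0"
      have "{x. g x \<noteq> 0} \<in> sets M"
        using measurable_sets[OF meas, of "- {0}"] by (simp add: vimage_def)
      \<comment> \<open>The rate becomes \<open>a * 2 / p\<close>, which exceeds 1, the threshold of
        the criterion at exponent 2.\<close>
      from energy_lower_exponent[OF t meas this fin _ _ p C le_g[OF t]]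
      show "energy 2 t g \<le> ennreal ((2 * measure M {x. g x \<noteq> 0} + C) * t powr (a * 2 / p))"
        by auto
    qed (use C p a in \<open>auto simp: field_simps\<close>)
  next
    case True
    have a': "a > 1 - (2 - p) * \<rho>"
      using a True by (auto simp: \<rho>_def)
    \<comment> \<open>Together with \<open>\<rho> \<le> 1 / 2\<close>, that is \<kappa> \<le>
      \<open>dW / 2\<close>, this keeps the threshold for \<open>a\<close> at least 1/2.\<close>
    have "(2 - p) * \<rho> \<le> 1 * \<rho>"
      using p \<rho> by (intro mult_right_mono) auto
    then have a0: "a > 0"
      using a' \<rho> by linarith
    \<comment> \<open>Young's inequality needs \<open>p > 1\<close>; the strict inequality for \<open>a\<close> leaves room to raise \<open>p = 1\<close>.\<close>
    define p' where "p' = (if p = 1 then 1 + min 1 ((a - 1 + \<rho>) / (2 * \<rho>)) else p)"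
    have p': "1 < p'" "p' \<le> 2" "p \<le> p'"
      using p True a' \<rho> by (auto simp: p'_def)
    have "a > 1 - (2 - p') * \<rho>"
    proof (cases "p = 1")
      case True
      \<comment> \<open>Raising the exponent from 1 to \<open>p'\<close> uses up at most half of the
        slack \<open>a - 1 + \<rho>\<close>.\<close>
      have "(p' - 1) * \<rho> \<le> (a - 1 + \<rho>) / (2 * \<rho>) * \<rho>"
        using True \<rho> by (intro mult_right_mono) (auto simp: p'_def)
      also have "\<dots> = (a - 1 + \<rho>) / 2"
        using \<rho> by simp
      also have "\<dots> < a - 1 + \<rho>"
        using a' True by simp
      finally show ?thesis by (simp add: algebra_simps)
    qed (use a' in \<open>simp add: p'_def\<close>)
    then show ?thesis
      using p p' C a0 unfolding \<rho>_def
      by (intro vanishing_of_small_energy[OF meas bounds fin, of p' C a])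
         (auto intro: order_trans[OF energy_antimono_exponent[OF diff] le_g])
  qed
  then show ?thesis by (simp add: g_def)
qed

lemma besov_space_energy:
  assumes f: "f \<in> besov_space M k p \<alpha>" and p: "p \<ge> 1"
  obtains C where "C \<ge> 0" "\<And>t. t > 0 \<Longrightarrow> energy p t f \<le> ennreal (C * t powr (p * \<alpha>))"
proof -
  have meas: "f \<in> borel_measurable M"
    using f by (auto simp: besov_space_def dest: Lp_measurable)
  have "besov_seminorm M k p \<alpha> f < \<infinity>"
    using f by (simp add: besov_space_def)
  then obtain b where b: "b \<ge> 0" "besov_seminorm M k p \<alpha> f = ennreal b"
    by (cases "besov_seminorm M k p \<alpha> f" rule: ennreal_cases) auto
  show thesis
  proof (rule that[of "b powr p"])
    fix t :: real
    assume t: "t > 0"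
    have *: "ennreal (t powr (- \<alpha>)) * ennreal_powr (energy p t f) (1 / p) \<le> ennreal b"
      unfolding b(2)[symmetric] besov_seminorm_def energy_eq_besov_integral[OF t meas, symmetric]
      using t by (intro SUP_upper) auto
    show "energy p t f \<le> ennreal (b powr p * t powr (p * \<alpha>))"
    proof (cases "energy p t f" rule: ennreal_cases)
      case (real e)
      then have "ennreal (t powr (- \<alpha>) * e powr (1 / p)) \<le> ennreal b"
        using * by (simp add: ennreal_powr_def ennreal_mult')
      then have "t powr (- \<alpha>) * e powr (1 / p) \<le> b"
        using b by simp
      then have "e powr (1 / p) \<le> b * t powr \<alpha>"
        using t by (simp add: powr_minus field_simps)
      then have "(e powr (1 / p)) powr p \<le> (b * t powr \<alpha>) powr p"
        using p by (intro powr_mono2) auto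
      then have "e \<le> b powr p * t powr (p * \<alpha>)"
        using p b real by (simp add: powr_powr powr_mult mult.commute)
      then show ?thesis
        using real by (simp add: ennreal_leI)
    next
      case top
      then have "ennreal (t powr (- \<alpha>)) * ennreal_powr (energy p t f) (1 / p) = \<infinity>"
        using t by (simp add: ennreal_powr_def ennreal_mult_eq_top_iff)
      then show ?thesis
        using * by (simp add: top_unique)
    qed
  qed simp
qed

text \<open>The truncations of \<open>f\<close> and of \<open>- f\<close> at the levels 1/(n+1)
  vanish outside one common null set, so |f| is below every level there.\<close>

lemma besov_trivialI:
  assumes \<kappa>: "\<kappa> \<le> dW / 2"
    and \<alpha>: "1 \<le> p \<and> p \<le> 2 \<and> \<alpha> > (1 - 2 / p) * (\<kappa> / dW) + 1 / p \<or> 2 \<le> p \<and> \<alpha> > 1 / 2"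
  shows "besov_trivial M k p \<alpha>"
  unfolding besov_trivial_def
proof
  fix f
  assume f: "f \<in> besov_space M k p \<alpha>"
  then have L: "f \<in> Lp M p"
    by (simp add: besov_space_def)
  then have L': "(\<lambda>x. - f x) \<in> Lp M p"
    by (auto simp: Lp_iff)
  have p: "p \<ge> 1" using \<alpha> by auto
  obtain C where C: "C \<ge> 0" and le: "\<And>t. t > 0 \<Longrightarrow> energy p t f \<le> ennreal (C * t powr (p * \<alpha>))"
    by (rule besov_space_energy[OF f p]) (rule that)
  have le': "energy p t (\<lambda>x. - f x) \<le> ennreal (C * t powr (p * \<alpha>))" if "t > 0" for t
    using p by (intro order_trans[OF energy_contraction le] that) auto
  have a: "1 \<le> p \<and> p \<le> 2 \<and> p * \<alpha> > 1 - (2 - p) * (\<kappa> / dW) \<or> 2 \<le> p \<and> p * \<alpha> > p / 2"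
  proof -
    have "p * \<alpha> > p * ((1 - 2 / p) * (\<kappa> / dW) + 1 / p)" if "\<alpha> > (1 - 2 / p) * (\<kappa> / dW) + 1 / p"
      using that p by (intro mult_strict_left_mono) auto
    moreover have "p * ((1 - 2 / p) * (\<kappa> / dW) + 1 / p) = 1 - (2 - p) * (\<kappa> / dW)"
      using p dW by (simp add: field_simps)
    moreover have "p * \<alpha> > p / 2" if "\<alpha> > 1 / 2"
      using mult_strict_left_mono[OF that, of p] p by simp
    ultimately show ?thesis
      using \<alpha> by auto
  qed
  have "AE x in M. \<forall>n. clip (1 / real (Suc n)) (f x) = 0 \<and> clip (1 / real (Suc n)) (- f x) = 0"
    unfolding AE_all_countable
    using clip_vanishes[OF L C le a \<kappa>] clip_vanishes[OF L' C le' a \<kappa>] by auto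
  then have "AE x in M. f x = 0"
  proof (rule eventually_mono)
    fix x
    assume *: "\<forall>n. clip (1 / real (Suc n)) (f x) = 0 \<and> clip (1 / real (Suc n)) (- f x) = 0"
    have "\<bar>f x\<bar> \<le> 1 / real (Suc n)" for n
      using *[rule_format, of n] by (auto simp: clip_def min_def max_def split: if_splits)
    then show "f x = 0"
      by (metis abs_le_zero_iff linorder_not_less nat_approx_posE order_less_le_trans less_irrefl zero_less_abs_iff)
  qed
  then show "\<exists>c. AE x in M. f x = c" by blast
qed

text \<open>Triviality holds strictly above \<open>b\<close>, so \<open>b + e\<close> is admissible
  for every \<open>e > 0\<close>. The infimum runs over positive exponents, which is why
  \<open>b > 0\<close> is checked first; for \<open>p \<le> 2\<close> this rests on \<kappa> \<le>
  \<open>dW / 2\<close>.\<close>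

lemma critical_exponent_le:
  assumes \<kappa>: "\<kappa> \<le> dW / 2"
    and b: "1 \<le> p \<and> p \<le> 2 \<and> b = (1 - 2 / p) * (\<kappa> / dW) + 1 / p \<or> 2 \<le> p \<and> b = 1 / 2"
  shows "critical_exponent M k p \<le> ereal b"
proof -
  have "b > 0"
  proof (cases "2 \<le> p \<and> b = 1 / 2")
    case False
    then have p: "1 \<le> p" "p \<le> 2" and b: "b = (1 - 2 / p) * (\<kappa> / dW) + 1 / p"
      using b by auto
    have "(2 / p - 1) * (\<kappa> / dW) \<le> (2 / p - 1) * (1 / 2)"
      using p \<kappa> dW by (intro mult_left_mono) (auto simp: field_simps)
    also have "\<dots> = 1 / p - 1 / 2"
      by (simp add: field_simps)
    finally have "(1 - 2 / p) * (\<kappa> / dW) \<ge> 1 / 2 - 1 / p"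
      by (simp add: algebra_simps)
    then have "b \<ge> 1 / 2"
      unfolding b by linarith
    then show ?thesis by simp
  qed simp
  show ?thesis
  proof (rule ereal_le_epsilon2)
    fix e :: real
    assume "e > 0"
    then have "besov_trivial M k p (b + e)"
      using b by (intro besov_trivialI \<kappa>) auto
    then have "critical_exponent M k p \<le> ereal (b + e)"
      unfolding critical_exponent_def using \<open>b > 0\<close> \<open>e > 0\<close> by (intro INF_lower) auto
    then show "critical_exponent M k p \<le> ereal b + ereal e"
      by simp
  qed
qed

subsection \<open>Nontriviality of Besov classes\<close>

text \<open>A bound independent of \<open>t\<close>, from the marginals; it takes care of large
  times in the Besov seminorm.\<close>

lemma energy_le_Lp:
  assumes f: "f \<in> Lp M p" and p: "p > 0" and t: "t > 0"
  shows "energy p t f \<le> ennreal (2 powr p * (2 * (\<integral>x. \<bar>f x\<bar> powr p \<partial>M)))"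
proof -
  have [measurable]: "f \<in> borel_measurable M"
    using f by (rule Lp_measurable)
  have le: "\<bar>x - y\<bar> powr p \<le> 2 powr p * (\<bar>x\<bar> powr p + \<bar>y\<bar> powr p)" for x y :: real
  proof -
    have "\<bar>x - y\<bar> powr p \<le> (2 * max \<bar>x\<bar> \<bar>y\<bar>) powr p"
      using p by (intro powr_mono2) auto
    also have "\<dots> = 2 powr p * max \<bar>x\<bar> \<bar>y\<bar> powr p"
      by (simp add: powr_mult)
    also have "\<dots> \<le> 2 powr p * (\<bar>x\<bar> powr p + \<bar>y\<bar> powr p)"
      by (intro mult_left_mono) (auto simp: max_def)
    finally show ?thesis .
  qed
  have "energy p t f \<le> (\<integral>\<^sup>+z. ennreal (2 powr p) * (ennreal (\<bar>f (fst z)\<bar> powr p) + ennreal (\<bar>f (snd z)\<bar> powr p)) \<partial>Q t)"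
    unfolding energy_def
    by (intro nn_integral_mono order_trans[OF ennreal_leI[OF le]]) (simp add: ennreal_mult')
  also have "\<dots> = ennreal (2 powr p) * ((\<integral>\<^sup>+x. ennreal (\<bar>f x\<bar> powr p) \<partial>M) + (\<integral>\<^sup>+x. ennreal (\<bar>f x\<bar> powr p) \<partial>M))"
    using nn_integral_Q_marginal[OF t, of "\<lambda>x. ennreal (\<bar>f x\<bar> powr p)"]
    by (simp add: nn_integral_cmult nn_integral_add)
  also have "(\<integral>\<^sup>+x. ennreal (\<bar>f x\<bar> powr p) \<partial>M) = ennreal (\<integral>x. \<bar>f x\<bar> powr p \<partial>M)"
    using f by (intro nn_integral_eq_integral) (auto simp: Lp_iff)
  also have "ennreal (2 powr p) * (ennreal (\<integral>x. \<bar>f x\<bar> powr p \<partial>M) + ennreal (\<integral>x. \<bar>f x\<bar> powr p \<partial>M))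
      = ennreal (2 powr p * (2 * (\<integral>x. \<bar>f x\<bar> powr p \<partial>M)))"
    by (simp add: ennreal_mult' flip: ennreal_plus)
  finally show ?thesis .
qed

text \<open>For \<open>t \<le> 1\<close> the rate \<beta> is stronger than \<alpha>, and for
  \<open>t > 1\<close> the uniform bound \<open>D\<close> is already enough.\<close>

lemma besov_spaceI:
  assumes f: "f \<in> Lp M p" and p: "p \<ge> 1" and C: "C \<ge> 0"
    and le: "\<And>t. t > 0 \<Longrightarrow> energy p t f \<le> ennreal (C * t powr (p * \<beta>))"
    and \<alpha>: "0 \<le> \<alpha>" "\<alpha> \<le> \<beta>"
  shows "f \<in> besov_space M k p \<alpha>"
proof -
  have meas: "f \<in> borel_measurable M"
    using f by (rule Lp_measurable)
  define D where "D = 2 powr p * (2 * (\<integral>x. \<bar>f x\<bar> powr p \<partial>M))"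
  have D: "D \<ge> 0"
    by (simp add: D_def)
  have "besov_seminorm M k p \<alpha> f \<le> ennreal ((C + D) powr (1 / p))"
    unfolding besov_seminorm_def
  proof (rule SUP_least)
    fix t :: real
    assume "t \<in> {0<..}"
    then have t: "t > 0" by simp
    have "energy p t f \<le> ennreal ((C + D) * t powr (p * \<alpha>))"
    proof (cases "t \<le> 1")
      case True
      have "C * t powr (p * \<beta>) \<le> (C + D) * t powr (p * \<alpha>)"
        using C D t p \<alpha> True by (intro mult_mono powr_mono') auto
      then show ?thesis
        using le[OF t] by (meson ennreal_leI order_trans)
    next
      case False
      then have "D * 1 \<le> (C + D) * t powr (p * \<alpha>)"
        using C D p \<alpha> by (intro mult_mono ge_one_powr_ge_zero) auto
      then show ?thesis
        using p unfolding D_def mult_1_right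
        by (intro order_trans[OF energy_le_Lp[OF f _ t] ennreal_leI]) auto
    qed
    then obtain e where e: "e \<ge> 0" "energy p t f = ennreal e" "e \<le> (C + D) * t powr (p * \<alpha>)"
      using C D by (cases "energy p t f" rule: ennreal_cases) (auto simp: top_unique ennreal_le_iff)
    have "e powr (1 / p) \<le> ((C + D) * t powr (p * \<alpha>)) powr (1 / p)"
      using e p by (intro powr_mono2) auto
    also have "\<dots> = (C + D) powr (1 / p) * t powr \<alpha>"
      using C D p by (simp add: powr_mult powr_powr)
    finally have "t powr (- \<alpha>) * e powr (1 / p) \<le> t powr (- \<alpha>) * ((C + D) powr (1 / p) * t powr \<alpha>)"
      by (intro mult_left_mono) auto
    also have "\<dots> = (C + D) powr (1 / p)"
      using t by (simp add: powr_minus)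
    finally have "ennreal (t powr (- \<alpha>) * e powr (1 / p)) \<le> ennreal ((C + D) powr (1 / p))"
      by (rule ennreal_leI)
    then show "ennreal (t powr (- \<alpha>)) *
        ennreal_powr (\<integral>\<^sup>+ y. \<integral>\<^sup>+ x. ennreal (\<bar>f x - f y\<bar> powr p * k t x y) \<partial>M \<partial>M) (1 / p)
        \<le> ennreal ((C + D) powr (1 / p))"
      unfolding energy_eq_besov_integral[OF t meas]
      using e by (simp add: ennreal_powr_def ennreal_mult')
  qed
  also have "\<dots> < \<infinity>" by simp
  finally show ?thesis
    using f by (simp add: besov_space_def)
qed

lemma Lp_constant:
  assumes f: "f \<in> Lp M p" and p: "p > 0" and c: "AE x in M. f x = c"
  shows "c = 0"
proof (rule ccontr)
  assume "c \<noteq> 0"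
  have "integrable M (\<lambda>x. \<bar>c\<bar> powr p) \<longleftrightarrow> integrable M (\<lambda>x. \<bar>f x\<bar> powr p)"
    using f c by (intro integrable_cong_AE) (auto simp: Lp_iff elim: eventually_mono)
  then show False
    using f \<open>c \<noteq> 0\<close> by (simp add: Lp_iff integrable_iff_bounded emeasure_UNIV ennreal_mult_top)
qed

text \<open>A single nonzero \<open>f\<close> with rate \<beta> lies in every class of smaller
  positive exponent, and it is not constant there because a constant in L^p is 0.\<close>

lemma le_critical_exponent:
  assumes f: "f \<in> Lp M p" and p: "p \<ge> 1" and C: "C \<ge> 0"
    and le: "\<And>t. t > 0 \<Longrightarrow> energy p t f \<le> ennreal (C * t powr (p * \<beta>))"
    and nonzero: "\<not> (AE x in M. f x = 0)"
  shows "ereal \<beta> \<le> critical_exponent M k p"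
  unfolding critical_exponent_def
proof (rule INF_greatest, rule ccontr)
  fix \<alpha>
  assume \<alpha>: "\<alpha> \<in> {\<alpha>. 0 < \<alpha> \<and> besov_trivial M k p \<alpha>}" and "\<not> ereal \<beta> \<le> ereal \<alpha>"
  then have "f \<in> besov_space M k p \<alpha>"
    by (intro besov_spaceI[OF f p C le]) auto
  then obtain c where c: "AE x in M. f x = c"
    using \<alpha> by (auto simp: besov_trivial_def)
  with Lp_constant[OF f _ c] p nonzero show False by auto
qed

text \<open>The initial datum of the nontrivial examples; \<open>undefined\<close> merely serves as
  some centre.\<close>

definition bump :: "'a \<Rightarrow> real" where
  "bump = indicator (ball undefined 1)"

lemma bump: "bump \<in> Lp M 2" "bump \<in> Linf M" "q > 0 \<Longrightarrow> bump \<in> Lp M q"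
proof -
  show *: "bump \<in> Lp M q" if "q > 0" for q
    unfolding bump_def using that ball_finite by (intro Lp_indicator) auto
  show "bump \<in> Lp M 2" by (rule *) simp
  have "emeasure M {x. bump x \<noteq> 0} \<le> emeasure M (ball undefined 1)"
    by (intro emeasure_mono) (auto simp: bump_def indicator_def split: if_splits)
  then show "bump \<in> Linf M"
    using ball_finite[of undefined 1] by (intro bounded_finite_support) (auto simp: bump_def indicator_def)
qed

text \<open>Mass is preserved and balls have positive measure. This shows that
  \<open>P 1 bump\<close> is not zero almost everywhere.\<close>

lemma integral_P_bump: "(\<integral>x. P 1 bump x \<partial>M) > 0"
proof -
  have "(\<integral>x. P 1 bump x \<partial>M) = measure M (ball undefined 1)"
    using bump(3)[of 1] by (simp add: P_integral Lp_1_iff) (simp add: bump_def)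
  moreover obtain c where "c > 0" "ennreal (c * 1 powr dH) \<le> emeasure M (ball undefined 1)"
    using ahlfors unfolding ahlfors_regular_def by (meson zero_less_one)
  ultimately show ?thesis
    using ball_finite[of undefined 1]
    by (simp add: emeasure_eq_ennreal_measure less_top zero_less_measure_iff) 
qed

text \<open>The witness is \<open>P 1 bump\<close>. Its energy rate from \<open>energy_P\<close> is
  \<open>p\<close> times the claimed exponent, in keeping with the \<open>p\<close>-th root in the
  seminorm.\<close>

lemma critical_exponent_ge:
  assumes p: "p \<ge> 2"
  shows "ereal ((1 - 2 / p) * (\<kappa> / dW) + 1 / p) \<le> critical_exponent M k p"
proof -
  obtain C where C: "C \<ge> 0" and le: "\<And>S t. S \<ge> 1 \<Longrightarrow> t > 0 \<Longrightarrow>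
      energy p t (P S bump) \<le> ennreal (C * t powr (1 + \<kappa> * (p - 2) / dW))"
    by (rule energy_P[OF p bump(1,2) zero_less_one]) (rule that)
  have eq: "1 + \<kappa> * (p - 2) / dW = p * ((1 - 2 / p) * (\<kappa> / dW) + 1 / p)"
    using p dW by (simp add: field_simps)
  show ?thesis
  proof (rule le_critical_exponent[OF _ _ C])
    show "P 1 bump \<in> Lp M p"
      using p by (intro P_Lp bump) auto
    show "energy p t (P 1 bump) \<le> ennreal (C * t powr (p * ((1 - 2 / p) * (\<kappa> / dW) + 1 / p)))"
      if "t > 0" for t
      using le[of 1 t] that unfolding eq by simp
    show "\<not> (AE x in M. P 1 bump x = 0)"
    proof
      assume "AE x in M. P 1 bump x = 0"
      then have "(\<integral>x. P 1 bump x \<partial>M) = 0"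
        by (rule integral_eq_zero_AE)
      then show False using integral_P_bump by simp
    qed
  qed (use p in auto)
qed

text \<open>\<open>P 1 bump\<close> has quadratic energy of order \<open>t\<close>. Cutting it off
  from below gives a support of finite measure, on which this yields the rate \<open>p / 2\<close>
  for exponent \<open>p\<close>.\<close>

lemma critical_exponent_ge_half:
  assumes p: "1 \<le> p" "p \<le> 2"
  shows "ereal (1 / 2) \<le> critical_exponent M k p"
proof -
  define v where "v = P 1 bump"
  have v: "v \<in> Lp M q" if "q \<ge> 1" for q
    unfolding v_def using that by (intro P_Lp bump) auto
  have [measurable]: "v \<in> borel_measurable M"
    using v[of 1] by (auto dest: Lp_measurable)
  \<comment> \<open>The integral of \<open>v\<close> is positive, so \<open>v\<close> exceeds some
    level 1/(n+1) on a set that is not null. Cutting at that level leaves a nonzero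
    function.\<close>
  have "\<not> (AE x in M. \<forall>n. v x \<le> 1 / real (Suc n))"
  proof
    assume "AE x in M. \<forall>n. v x \<le> 1 / real (Suc n)"
    then have "AE x in M. v x \<le> 0"
    proof (rule eventually_mono)
      fix x
      assume "\<forall>n. v x \<le> 1 / real (Suc n)"
      then show "v x \<le> 0"
        by (meson nat_approx_posE linorder_not_less)
    qed
    then have "0 \<le> (\<integral>x. - v x \<partial>M)"
      by (intro integral_nonneg_AE) (auto elim: eventually_mono)
    then show False using integral_P_bump by (simp add: v_def)
  qed
  then obtain n where n: "\<not> (AE x in M. v x \<le> 1 / real (Suc n))"
    by (auto simp: AE_all_countable)
  define \<epsilon> where "\<epsilon> = 1 / real (Suc n)"
  have \<epsilon>: "\<epsilon> > 0" by (simp add: \<epsilon>_def)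
  define w where "w = (\<lambda>x. max 0 (v x - \<epsilon>))"
  define A where "A = {x. v x > \<epsilon>}"
  define C where "C = 4 * L2_inner M bump bump"
  have C: "C \<ge> 0"
    unfolding C_def L2_inner_def by (intro mult_nonneg_nonneg integral_nonneg_AE) auto
  have [measurable]: "w \<in> borel_measurable M"
    unfolding w_def by measurable
  have A: "A \<in> sets M"
    using measurable_sets[of v M borel "{\<epsilon><..}"] by (simp add: A_def vimage_def)
  have fin: "emeasure M A < \<infinity>"
    unfolding A_def using \<epsilon> by (intro finite_superlevel[OF v[of 1]]) auto
  have "w \<in> Lp M p"
    unfolding Lp_iff
  proof
    show "integrable M (\<lambda>x. \<bar>w x\<bar> powr p)"
      by (rule Bochner_Integration.integrable_bound[of M "\<lambda>x. \<bar>v x\<bar> powr p"])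
         (use v[OF p(1)] \<epsilon> p in \<open>auto simp: Lp_iff w_def intro!: powr_mono2\<close>)
  qed simp
  moreover have "energy p t w \<le> ennreal ((2 * measure M A + C) * t powr (p * (1 / 2)))" if t: "t > 0" for t
  proof -
    have "energy 2 t w \<le> energy 2 t v"
      by (intro energy_contraction) (auto simp: w_def)
    also have "\<dots> \<le> ennreal (C * t powr 1)"
      using energy_2_P[OF bump(1) zero_less_one t] t by (simp add: v_def C_def mult_ac)
    finally have "energy p t w \<le> ennreal ((2 * measure M A + C) * t powr (1 * p / 2))"
      using p by (intro energy_lower_exponent[OF t _ A fin] C) (auto simp: A_def w_def)
    then show ?thesis by simp
  qed
  moreover have "\<not> (AE x in M. w x = 0)"
  proof
    assume "AE x in M. w x = 0"
    then have "AE x in M. v x \<le> \<epsilon>"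
      by (rule eventually_mono) (auto simp: w_def max_def split: if_splits)
    then show False using n by (simp add: \<epsilon>_def)
  qed
  ultimately show ?thesis
    using p C by (intro le_critical_exponent[where C = "2 * measure M A + C"]) auto
qed

end

theorem theorem0p19:
  fixes M :: "'a::metric_space measure"
    and \<E> :: "('a \<Rightarrow> real) \<Rightarrow> ('a \<Rightarrow> real) \<Rightarrow> real"
    and \<F> :: "('a \<Rightarrow> real) set"
    and P :: "real \<Rightarrow> ('a \<Rightarrow> real) \<Rightarrow> 'a \<Rightarrow> real"
    and k :: "real \<Rightarrow> 'a \<Rightarrow> 'a \<Rightarrow> real"
    and dH dW \<kappa> :: real
  assumes "metric_measure_space M"
    and "ahlfors_regular M dH"
    and "dirichlet_form M \<E> \<F>"
    and "regular_form M \<E> \<F>"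
    and "strongly_local_form M \<E> \<F>"
    and "heat_semigroup M \<E> \<F> P"
    and "conservative M P"
    and "heat_kernel M P k"
    and "sub_gaussian_estimates M k dH dW"
    and "weak_bakry_emery M P dW \<kappa>"
    and "0 < \<kappa>" and "\<kappa> \<le> dW / 2"
  shows "(\<forall>p::real. 1 \<le> p \<and> p \<le> 2 \<longrightarrow>
            ereal (1 / 2) \<le> critical_exponent M k p \<and>
            critical_exponent M k p \<le> ereal ((1 - 2 / p) * (\<kappa> / dW) + 1 / p)) \<and>
         (\<forall>p::real. 2 \<le> p \<longrightarrow>
            ereal ((1 - 2 / p) * (\<kappa> / dW) + 1 / p) \<le> critical_exponent M k p \<and>
            critical_exponent M k p \<le> ereal (1 / 2))"
proof -
  interpret heat_kernel_space M P k dH dW \<kappa>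
    using assms by unfold_locales (auto simp: heat_semigroup_def)
  show ?thesis
    using critical_exponent_ge_half critical_exponent_ge critical_exponent_le[OF assms(12)] by blast
qed

end
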